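(* Assume that $\mathbb{E}|L_1|<\infty$, $\mathbb{E}|\log m_0(t)|<\infty$ and $\mathbb{E}\left|\frac{m_0'(t)}{m_0(t)}\right|<\infty$ for all $t\in\mathbb{R}$. Then for almost every $\xi$, the sequence of finite measures $A\mapsto\mathbb{E}_\xi Z_n(nA)$ satisfies a large deviation principle with rate function $\Lambda^*$: for each measurable (Borel) subset $A$ of $\mathbb{R}$, $$-\inf_{x\in A^o}\Lambda^*(x)\le\liminf_{n\to\infty}\frac1n\log\mathbb{E}_\xi Z_n(nA)\le\limsup_{n\to\infty}\frac1n\log\mathbb{E}_\xi Z_n(nA)\le-\inf_{x\in\bar A}\Lambda^*(x),$$ where $A^o$ denotes the interior of $A$ and $\bar A$ its closure.
   Context: Branching random walk in a random environment in time. Let $\xi=(\xi_n)_{n\ge 0}$ be a stationary and ergodic sequence of random variables with values in a measurable space $\Theta$; each realization of $\xi_n$ determines a probability distribution $\eta_n=\eta(\xi_n)$ on $\mathbb{N}\times\mathbb{R}\times\mathbb{R}\times\cdots$. Given $\xi$ (quenched law $\mathbb{P}_\xi$, expectation $\mathbb{E}_\xi$), let $X(u)=(N(u),L_1(u),L_2(u),\dots)$, indexed by finite sequences $u\in\{\emptyset\}\cup\bigcup_{n\ge1}\mathbb{N}^n$, be independent random vectors, $X(u)$ having law $\eta_n$ when the length $|u|$ equals $n$ (values $L_i(u)$ with $i>N(u)$ play no role in the process; one may take them to be $0$). The initial particle $\emptyset$ is at $S_\emptyset=0$; each particle $u$ of generation $n$, located at $S_u$, is replaced by $N(u)$ particles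 $ui$ of generation $n+1$ located at $S_{ui}=S_u+L_i(u)$, $1\le i\le N(u)$. Let $\mathbb{T}_n$ be the set of particles of generation $n$ and $Z_n=\sum_{u\in\mathbb{T}_n}\delta_{S_u}$ their counting measure. The annealed law $\mathbb{P}$ (expectation $\mathbb{E}$) is $\mathbb{P}_\xi$ integrated against the law of $\xi$. Write $N=N(\emptyset)$, $L_i=L_i(\emptyset)$, and $m_n=\mathbb{E}_\xi N(u)$ for $|u|=n$. Standing assumption: $\mathbb{E}\log m_0\in(0,\infty)$ and $\mathbb{E}\frac{N}{m_0}\log^+N<\infty$. Notation: $m_0(t)=\mathbb{E}_\xi\sum_{i=1}^{N}e^{tL_i}$, $\Lambda(t)=\mathbb{E}\log m_0(t)$, and $\Lambda^*(x)=\sup_{t\in\mathbb{R}}\{xt-\Lambda(t)\}$. Also $nA=\{nx:x\in A\}$; $\log0=-\infty$ and $\inf\emptyset=+\infty$. *)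

theory Defs
  imports "HOL-Probability.Probability"
begin

definition elog :: "ennreal \<Rightarrow> ereal" where
  "elog x = (if x = 0 then -\<infinity> else if x = \<top> then \<infinity> else ereal (ln (enn2real x)))"

definition process_law :: "'a measure \<Rightarrow> 'th measure \<Rightarrow> (nat \<Rightarrow> 'a \<Rightarrow> 'th) \<Rightarrow> (nat \<Rightarrow> 'th) measure" where
  "process_law M \<Theta> \<xi> = distr M (\<Pi>\<^sub>M n\<in>UNIV. \<Theta>) (\<lambda>\<omega> n. \<xi> n \<omega>)"

definition stationary :: "'a measure \<Rightarrow> 'th measure \<Rightarrow> (nat \<Rightarrow> 'a \<Rightarrow> 'th) \<Rightarrow> bool" where
  "stationary M \<Theta> \<xi> \<longleftrightarrow> process_law M \<Theta> (\<lambda>n. \<xi> (Suc n)) = process_law M \<Theta> \<xi>"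

definition ergodic :: "'a measure \<Rightarrow> 'th measure \<Rightarrow> (nat \<Rightarrow> 'a \<Rightarrow> 'th) \<Rightarrow> bool" where
  "ergodic M \<Theta> \<xi> \<longleftrightarrow>
    (\<forall>A\<in>sets (\<Pi>\<^sub>M n\<in>(UNIV :: nat set). \<Theta>).
       (\<lambda>e n. e (Suc n)) -` A \<inter> space (\<Pi>\<^sub>M n\<in>(UNIV :: nat set). \<Theta>) = A \<longrightarrow>
       measure (process_law M \<Theta> \<xi>) A = 0 \<or> measure (process_law M \<Theta> \<xi>) A = 1)"

text \<open>
  A point \<open>(N, L)\<close> of the offspring space stands for \<open>(N, L\<^sub>1, L\<^sub>2, \<dots>)\<close> with the displacements
  numbered from zero: \<open>L i\<close> is the displacement of the child number \<open>i + 1\<close>.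
\<close>

type_synonym offspring = "nat \<times> (nat \<Rightarrow> real)"

definition offspring_space :: "offspring measure" where
  "offspring_space = count_space UNIV \<Otimes>\<^sub>M (\<Pi>\<^sub>M i\<in>UNIV. borel)"

text \<open>
  A particle is a finite word, stored in reverse: the child \<open>ui\<close> of \<open>u\<close> is \<open>i # u\<close>, and the
  initial particle is \<open>[]\<close>. A realization of the family of the vectors \<open>X(u)\<close> is a function
  \<open>x\<close> on words, and \<open>e\<close> is a realization of the environment.
\<close>

definition quenched_law :: "('th \<Rightarrow> offspring measure) \<Rightarrow> (nat \<Rightarrow> 'th) \<Rightarrow> (nat list \<Rightarrow> offspring) measure" where
  "quenched_law \<eta> e = (\<Pi>\<^sub>M u\<in>UNIV. \<eta> (e (length u)))"

primrec particles :: "(nat list \<Rightarrow> offspring) \<Rightarrow> nat \<Rightarrow> nat list set" where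
  "particles x 0 = {[]}"
| "particles x (Suc n) = {i # u | i u. u \<in> particles x n \<and> i < fst (x u)}"

primrec position :: "(nat list \<Rightarrow> offspring) \<Rightarrow> nat list \<Rightarrow> real" where
  "position x [] = 0"
| "position x (i # u) = position x u + snd (x u) i"

text \<open>The image of a counting measure under a map is the sum of the Dirac masses at its values.\<close>

definition Z :: "(nat list \<Rightarrow> offspring) \<Rightarrow> nat \<Rightarrow> real measure" where
  "Z x n = distr (count_space (particles x n)) borel (position x)"

definition scaled_mean :: "('th \<Rightarrow> offspring measure) \<Rightarrow> (nat \<Rightarrow> 'th) \<Rightarrow> nat \<Rightarrow> real set \<Rightarrow> ennreal" where
  "scaled_mean \<eta> e n A = (\<integral>\<^sup>+x. emeasure (Z x n) ((\<lambda>y. real n * y) ` A) \<partial>quenched_law \<eta> e)"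

definition annealed_nn_expectation ::
  "('th \<Rightarrow> offspring measure) \<Rightarrow> (nat \<Rightarrow> 'th) measure \<Rightarrow>
    ((nat \<Rightarrow> 'th) \<Rightarrow> (nat list \<Rightarrow> offspring) \<Rightarrow> ennreal) \<Rightarrow> ennreal" where
  "annealed_nn_expectation \<eta> \<tau> f = (\<integral>\<^sup>+e. (\<integral>\<^sup>+x. f e x \<partial>quenched_law \<eta> e) \<partial>\<tau>)"

definition mean_offspring :: "('th \<Rightarrow> offspring measure) \<Rightarrow> (nat \<Rightarrow> 'th) \<Rightarrow> ennreal" where
  "mean_offspring \<eta> e = (\<integral>\<^sup>+x. of_nat (fst (x [])) \<partial>quenched_law \<eta> e)"

definition laplace :: "('th \<Rightarrow> offspring measure) \<Rightarrow> (nat \<Rightarrow> 'th) \<Rightarrow> real \<Rightarrow> ennreal" where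
  "laplace \<eta> e t = (\<integral>\<^sup>+x. (\<Sum>i<fst (x []). ennreal (exp (t * snd (x []) i))) \<partial>quenched_law \<eta> e)"

text \<open>
  A function with values in the extended reals has a finite expectation if its absolute value has.
  The expectation is then the integral of its real part, because infinite values have
  probability zero.
\<close>

definition ereal_integrable :: "'b measure \<Rightarrow> ('b \<Rightarrow> ereal) \<Rightarrow> bool" where
  "ereal_integrable \<tau> f \<longleftrightarrow> f \<in> borel_measurable \<tau> \<and> (\<integral>\<^sup>+e. e2ennreal \<bar>f e\<bar> \<partial>\<tau>) < \<infinity>"

definition ereal_expectation :: "'b measure \<Rightarrow> ('b \<Rightarrow> ereal) \<Rightarrow> real" where
  "ereal_expectation \<tau> f = (\<integral>e. real_of_ereal (f e) \<partial>\<tau>)"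

definition \<Lambda> :: "('th \<Rightarrow> offspring measure) \<Rightarrow> (nat \<Rightarrow> 'th) measure \<Rightarrow> real \<Rightarrow> real" where
  "\<Lambda> \<eta> \<tau> t = ereal_expectation \<tau> (\<lambda>e. elog (laplace \<eta> e t))"

definition \<Lambda>_star :: "('th \<Rightarrow> offspring measure) \<Rightarrow> (nat \<Rightarrow> 'th) measure \<Rightarrow> real \<Rightarrow> ereal" where
  "\<Lambda>_star \<eta> \<tau> x = (SUP t::real. ereal (x * t - \<Lambda> \<eta> \<tau> t))"

end

theory Submission
  imports Defs
begin

text \<open>
  The expected number of generation-\<open>n\<close> particles in a Borel set defines an intensity measure whose
  exponential moment at \<open>t\<close> is the product of the one-step moments along the shifted environments.
  By Birkhoff's ergodic theorem the normalised logarithm of this product converges to \<open>\<Lambda> t\<close>, almost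
  surely for all rational \<open>t\<close>, hence by convexity for all real \<open>t\<close>. The limit is smooth: the
  symmetric second difference quotients of the one-step log-moments decrease to zero and are dominated by
  an integrable function, so those of \<open>\<Lambda>\<close> tend to zero. The Gartner-Ellis argument
  (exponential Chebyshev bounds and compactness from above, exponential tilting from below) then
  gives the large deviation principle.
\<close>

section \<open>Birkhoff's ergodic theorem\<close>

text \<open>The exceptional null set may depend neither on \<open>t\<close> nor on \<open>A\<close>.
  So the ergodic theorem is used for countably many \<open>t\<close> only, and everything after it
  is deterministic, for one fixed environment. The lower bound needs smoothness of \<Lambda>, in the
  form that its second difference at step h = 1/(k+1) is o(h). For a fixed environment the second
  difference of the log-moment is at most C h^2, but C depends on the environment and is not shown
  to be integrable. It is used only for pointwise convergence. Domination comes from convexity: the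
  second difference at step h is at most h times the one at step 1, an integrable combination of
  three log-moments. Dominated convergence thus replaces differentiation under the expectation. The
  measures involved are not probabilities: \<open>\<Lambda> 0\<close> is the expected log of the
  mean offspring number, so \<open>\<Lambda>_star\<close> may be negative, and no step may normalise
  silently.\<close>

lemma integrable_comp_preserving:
  fixes f :: "'a \<Rightarrow> real"
  assumes T: "T \<in> \<tau> \<rightarrow>\<^sub>M \<tau>" and inv: "distr \<tau> \<tau> T = \<tau>" and f: "integrable \<tau> f"
  shows "integrable \<tau> (\<lambda>x. f (T x))" "(\<integral>x. f (T x) \<partial>\<tau>) = (\<integral>x. f x \<partial>\<tau>)"
proof -
  have m: "f \<in> borel_measurable \<tau>" using f by auto
  show "integrable \<tau> (\<lambda>x. f (T x))"
    using f integrable_distr_eq[OF T m] by (simp add: inv)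
  show "(\<integral>x. f (T x) \<partial>\<tau>) = (\<integral>x. f x \<partial>\<tau>)"
    using integral_distr[OF T m] by (simp add: inv)
qed

text \<open>Garsia's argument for the maximal ergodic theorem. Unboundedness of the partial sums is
  an invariant event. If it had probability one, the increments
  \<open>F (Suc n) x - F n (T x)\<close> would converge dominatedly to \<open>f\<close>; their
  integrals are nonnegative by invariance and monotonicity of \<open>F\<close>, contradicting the
  negative mean.\<close>

lemma ergodic_sums_bounded:
  fixes f :: "'a \<Rightarrow> real"
  assumes "prob_space \<tau>" and T[measurable]: "T \<in> \<tau> \<rightarrow>\<^sub>M \<tau>" and inv: "distr \<tau> \<tau> T = \<tau>"
    and erg: "\<And>A. A \<in> sets \<tau> \<Longrightarrow> T -` A \<inter> space \<tau> = A \<Longrightarrow> measure \<tau> A = 0 \<or> measure \<tau> A = 1"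
    and f: "integrable \<tau> f" and neg: "(\<integral>x. f x \<partial>\<tau>) < 0"
  shows "AE x in \<tau>. \<exists>B. \<forall>n. (\<Sum>k<n. f ((T ^^ k) x)) \<le> B"
proof -
  interpret prob_space \<tau> by fact
  define S where "S n x = (\<Sum>k<n. f ((T ^^ k) x))" for n x
  \<comment> \<open>\<open>F n x\<close> is the maximum of \<open>S k x\<close> over k \<le> n; the
    recursion peels off the first summand instead of the last.\<close>
  define F where "F = rec_nat (\<lambda>x. 0) (\<lambda>n g x. max 0 (f x + g (T x)))"
  have F0: "F 0 x = 0" and FS: "F (Suc n) x = max 0 (f x + F n (T x))" for n x
    by (simp_all add: F_def)
  have [measurable]: "f \<in> borel_measurable \<tau>" using f by auto
  have [measurable]: "S n \<in> borel_measurable \<tau>" for n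
  proof -
    have [measurable]: "T ^^ k \<in> \<tau> \<rightarrow>\<^sub>M \<tau>" for k
      by (rule measurable_compose_n) (rule T)
    show ?thesis unfolding S_def by measurable
  qed
  have S_Suc: "S (Suc n) x = f x + S n (T x)" for n x
    unfolding S_def by (subst sum.lessThan_Suc_shift) (simp add: funpow_Suc_right del: funpow.simps)
  have F_nonneg: "F n x \<ge> 0" for n x by (cases n) (simp_all add: F0 FS)
  have F_mono: "F n x \<le> F (Suc n) x" for n x
  proof (induction n arbitrary: x)
    case (Suc n x)
    have "F n (T x) \<le> F (Suc n) (T x)" by (rule Suc)
    then show ?case unfolding FS[of "Suc n"] FS[of n x] by simp
  qed (simp add: F0 F_nonneg)
  have F_ge: "S n x \<le> F n x" for n x
  proof (induction n arbitrary: x)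
    case (Suc n x)
    have "S n (T x) \<le> F n (T x)" by (rule Suc)
    then show ?case unfolding S_Suc FS by linarith
  qed (simp add: S_def F0)
  have F_int: "integrable \<tau> (F n)" for n
  proof (induction n)
    case (Suc n)
    have "integrable \<tau> (\<lambda>x. f x + F n (T x))"
      by (intro Bochner_Integration.integrable_add f integrable_comp_preserving(1)[OF T inv] Suc)
    then show ?case unfolding FS by (intro integrable_max) simp_all
  qed (simp add: F_def)
  \<comment> \<open>Natural bounds keep the event a countable combination, hence measurable.\<close>
  define A where "A = {x \<in> space \<tau>. \<forall>B::nat. \<exists>n. S n x > real B}"
  have A_sets: "A \<in> sets \<tau>" unfolding A_def by measurable
  have A_iff: "x \<in> A \<longleftrightarrow> T x \<in> A" if "x \<in> space \<tau>" for x
  proof -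
    have Tx: "T x \<in> space \<tau>" using that measurable_space[OF T] by blast
    have "(\<forall>B::nat. \<exists>n. S n x > real B) \<longleftrightarrow> (\<forall>B::nat. \<exists>n. S n (T x) > real B)"
    proof safe
      fix B :: nat assume *: "\<forall>B::nat. \<exists>n. S n x > real B"
      obtain K :: nat where K: "real K > real B + \<bar>f x\<bar>" using reals_Archimedean2 by blast
      obtain n where n: "S n x > real K" using * by blast
      then obtain n' where "n = Suc n'" using K by (cases n) (auto simp: S_def)
      then show "\<exists>n. S n (T x) > real B" using n K by (intro exI[of _ n']) (simp add: S_Suc)
    next
      fix B :: nat assume *: "\<forall>B::nat. \<exists>n. S n (T x) > real B"
      obtain K :: nat where K: "real K > real B + \<bar>f x\<bar>" using reals_Archimedean2 by blast
      obtain n where n: "S n (T x) > real K" using * by blast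
      then show "\<exists>n. S n x > real B" using n K by (intro exI[of _ "Suc n"]) (simp add: S_Suc)
    qed
    then show ?thesis using that Tx by (simp add: A_def)
  qed
  have "T -` A \<inter> space \<tau> = A" using A_iff by (auto simp: A_def)
  from erg[OF A_sets this] show ?thesis
  proof
    assume "measure \<tau> A = 0"
    then have "AE x in \<tau>. x \<notin> A"
      using A_sets by (intro AE_not_in null_setsI) (simp_all add: emeasure_eq_measure)
    with AE_space show ?thesis
    proof eventually_elim
      case (elim x)
      then obtain B :: nat where "\<And>n. S n x \<le> real B" by (auto simp: A_def not_less)
      then show ?case unfolding S_def by blast
    qed
  next
    assume "measure \<tau> A = 1"
    then have AA: "AE x in \<tau>. x \<in> A" using AE_in_set_eq_1[OF A_sets] by blast
    define G where "G n x = F (Suc n) x - F n (T x)" for n x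
    \<comment> \<open>Since \<open>F\<close> is nonnegative, this form shows both that |G| \<le> |f|
      and that \<open>G n x = f x\<close> as soon as \<open>F n (T x)\<close> exceeds |f x|.\<close>
    have G_eq: "G n x = max (- F n (T x)) (f x)" for n x unfolding G_def FS by auto
    have "(\<lambda>n. \<integral>x. G n x \<partial>\<tau>) \<longlonglongrightarrow> (\<integral>x. f x \<partial>\<tau>)"
    proof (rule integral_dominated_convergence)
      show "integrable \<tau> (\<lambda>x. \<bar>f x\<bar>)" using f by simp
      show "AE x in \<tau>. norm (G n x) \<le> \<bar>f x\<bar>" for n
      proof (rule AE_I2)
        fix x show "norm (G n x) \<le> \<bar>f x\<bar>"
          using F_nonneg[of n "T x"] unfolding G_eq real_norm_def by linarith
      qed
      show "AE x in \<tau>. (\<lambda>n. G n x) \<longlonglongrightarrow> f x"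
        using AA
      proof eventually_elim
        case (elim x)
        then have "T x \<in> A" using A_iff A_def by blast
        obtain K :: nat where K: "real K > \<bar>f x\<bar>" using reals_Archimedean2 by blast
        obtain N where N: "S N (T x) > real K" using \<open>T x \<in> A\<close> A_def by blast
        have "G n x = f x" if "n \<ge> N" for n
        proof -
          have "F N (T x) \<le> F n (T x)" by (rule lift_Suc_mono_le[of "\<lambda>n. F n (T x)"]) (use F_mono that in auto)
          then show ?thesis using N K F_ge[of N "T x"] unfolding G_eq by auto
        qed
        then show ?case by (intro tendsto_eventually eventually_sequentiallyI)
      qed
    qed (use F_int integrable_comp_preserving(1)[OF T inv F_int] in \<open>auto simp: G_def\<close>)
    moreover have "(\<integral>x. G n x \<partial>\<tau>) \<ge> 0" for n
    proof -
      have "(\<integral>x. G n x \<partial>\<tau>) = (\<integral>x. F (Suc n) x \<partial>\<tau>) - (\<integral>x. F n x \<partial>\<tau>)"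
        unfolding G_def using F_int integrable_comp_preserving[OF T inv F_int] by simp
      moreover have "(\<integral>x. F n x \<partial>\<tau>) \<le> (\<integral>x. F (Suc n) x \<partial>\<tau>)"
        by (intro integral_mono F_int F_mono)
      ultimately show ?thesis by simp
    qed
    ultimately have "(\<integral>x. f x \<partial>\<tau>) \<ge> 0" by (intro LIMSEQ_le_const) auto
    with neg show ?thesis by simp
  qed
qed

text \<open>Centring \<open>f\<close> slightly above its mean gives a negative integral, so the
  centred sums are bounded, and dividing by \<open>n\<close> removes the bound. The excess 1/(j+1)
  runs through countably many values to keep one null set for all \<open>r\<close>.\<close>

lemma ergodic_average_upper:
  fixes f :: "'a \<Rightarrow> real"
  assumes "prob_space \<tau>" and T: "T \<in> \<tau> \<rightarrow>\<^sub>M \<tau>" and inv: "distr \<tau> \<tau> T = \<tau>"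
    and erg: "\<And>A. A \<in> sets \<tau> \<Longrightarrow> T -` A \<inter> space \<tau> = A \<Longrightarrow> measure \<tau> A = 0 \<or> measure \<tau> A = 1"
    and f: "integrable \<tau> f"
  shows "AE x in \<tau>. \<forall>r > (\<integral>x. f x \<partial>\<tau>). \<forall>\<^sub>F n in sequentially. (\<Sum>k<n. f ((T ^^ k) x)) / real n < r"
proof -
  interpret prob_space \<tau> by fact
  let ?m = "\<integral>x. f x \<partial>\<tau>"
  have "AE x in \<tau>. \<forall>j::nat. \<exists>B. \<forall>n. (\<Sum>k<n. f ((T ^^ k) x) - (?m + 1 / Suc j)) \<le> B"
  proof (subst AE_all_countable, rule allI)
    fix j :: nat
    have "(\<integral>x. f x - (?m + 1 / Suc j) \<partial>\<tau>) < 0" using f by (simp add: prob_space)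
    then show "AE x in \<tau>. \<exists>B. \<forall>n. (\<Sum>k<n. f ((T ^^ k) x) - (?m + 1 / Suc j)) \<le> B"
      by (intro ergodic_sums_bounded assms) (use f in auto)
  qed
  then show ?thesis
  proof eventually_elim
    case (elim x)
    show ?case
    proof (intro allI impI)
      fix r assume "r > ?m"
      then obtain j :: nat where j: "1 / Suc j < r - ?m"
        by (metis diff_gt_0_iff_gt nat_approx_posE)
      obtain B where B: "\<And>n. (\<Sum>k<n. f ((T ^^ k) x) - (?m + 1 / Suc j)) \<le> B" using elim by blast
      let ?d = "r - (?m + 1 / Suc j)"
      have d: "?d > 0" using j by simp
      obtain N :: nat where N: "real N > B / ?d" using reals_Archimedean2 by blast
      show "\<forall>\<^sub>F n in sequentially. (\<Sum>k<n. f ((T ^^ k) x)) / real n < r"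
      proof (rule eventually_sequentiallyI[of "Suc N"])
        fix n assume n: "n \<ge> Suc N"
        have "B / ?d < real n" using N n by linarith
        then have "B < real n * ?d" using d by (simp add: pos_divide_less_eq)
        moreover have "(\<Sum>k<n. f ((T ^^ k) x)) \<le> B + real n * (?m + 1 / Suc j)"
          using B[of n] by (simp add: sum_subtractf)
        ultimately have "(\<Sum>k<n. f ((T ^^ k) x)) < real n * r" by (simp add: algebra_simps)
        then show "(\<Sum>k<n. f ((T ^^ k) x)) / real n < r" using n by (simp add: divide_less_eq mult.commute)
      qed
    qed
  qed
qed

theorem birkhoff_ergodic:
  fixes f :: "'a \<Rightarrow> real"
  assumes "prob_space \<tau>" and T: "T \<in> \<tau> \<rightarrow>\<^sub>M \<tau>" and inv: "distr \<tau> \<tau> T = \<tau>"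
    and erg: "\<And>A. A \<in> sets \<tau> \<Longrightarrow> T -` A \<inter> space \<tau> = A \<Longrightarrow> measure \<tau> A = 0 \<or> measure \<tau> A = 1"
    and f: "integrable \<tau> f"
  shows "AE x in \<tau>. (\<lambda>n. (\<Sum>k<n. f ((T ^^ k) x)) / real n) \<longlonglongrightarrow> (\<integral>x. f x \<partial>\<tau>)"
proof -
  have "integrable \<tau> (\<lambda>x. - f x)" using f by simp
  have "AE x in \<tau>. \<forall>r > (\<integral>x. - f x \<partial>\<tau>). \<forall>\<^sub>F n in sequentially. (\<Sum>k<n. - f ((T ^^ k) x)) / real n < r"
    by (rule ergodic_average_upper[OF assms(1-3) erg \<open>integrable \<tau> (\<lambda>x. - f x)\<close>])
  moreover have "AE x in \<tau>. \<forall>r > (\<integral>x. f x \<partial>\<tau>). \<forall>\<^sub>F n in sequentially. (\<Sum>k<n. f ((T ^^ k) x)) / real n < r"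
    by (rule ergodic_average_upper[OF assms(1-3) erg f])
  ultimately show ?thesis
  proof eventually_elim
    case (elim x)
    show ?case
    proof (rule order_tendstoI)
      fix a assume "a < (\<integral>x. f x \<partial>\<tau>)"
      then have "\<forall>\<^sub>F n in sequentially. (\<Sum>k<n. - f ((T ^^ k) x)) / real n < - a" using elim(1) by simp
      then show "\<forall>\<^sub>F n in sequentially. a < (\<Sum>k<n. f ((T ^^ k) x)) / real n"
        by (simp add: sum_negf)
    qed (use elim(2) in blast)
  qed
qed

section \<open>Logarithmic exponential moments\<close>

definition exp_moment :: "real measure \<Rightarrow> real \<Rightarrow> ennreal" where
  "exp_moment \<mu> t = (\<integral>\<^sup>+y. ennreal (exp (t * y)) \<partial>\<mu>)"

definition log_moment :: "real measure \<Rightarrow> real \<Rightarrow> real" where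
  "log_moment \<mu> t = ln (enn2real (exp_moment \<mu> t))"

text \<open>Positivity rules out the zero measure. Both bounds are there because
  \<open>enn2real\<close> and \<open>ln\<close> are total: outside them \<open>log_moment\<close>
  would be a mere default value.\<close>

definition exp_moments_finite :: "real measure \<Rightarrow> bool" where
  "exp_moments_finite \<mu> \<longleftrightarrow> sets \<mu> = sets borel \<and> (\<forall>t. 0 < exp_moment \<mu> t \<and> exp_moment \<mu> t < \<infinity>)"

lemma exp_moment_eq:
  assumes "exp_moments_finite \<mu>"
  shows "exp_moment \<mu> t = ennreal (exp (log_moment \<mu> t))"
proof -
  have *: "0 < exp_moment \<mu> t" "exp_moment \<mu> t < \<infinity>" using assms by (auto simp: exp_moments_finite_def)
  then have "enn2real (exp_moment \<mu> t) > 0" by (simp add: enn2real_positive_iff)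
  then show ?thesis using * by (simp add: log_moment_def)
qed

lemma elog_exp: "elog (ennreal (exp c)) = ereal c"
  by (simp add: elog_def)

lemma elog_exp_moment:
  assumes "exp_moments_finite \<mu>"
  shows "elog (exp_moment \<mu> t) = ereal (log_moment \<mu> t)"
  unfolding exp_moment_eq[OF assms] elog_exp ..

text \<open>Between two rationals p < t < q one has exp(ty) \<le> exp(py) + exp(qy). A vanishing
  moment at one \<open>t\<close> forces the measure to vanish, which the rational 0 excludes. This
  turns countably many almost sure statements into one for all \<open>t\<close>.\<close>

lemma exp_moments_finiteI:
  assumes sets: "sets \<mu> = sets borel"
    and rat: "\<And>q. q \<in> \<rat> \<Longrightarrow> 0 < exp_moment \<mu> q \<and> exp_moment \<mu> q < \<infinity>"
  shows "exp_moments_finite \<mu>"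
  unfolding exp_moments_finite_def
proof (intro conjI allI sets)
  note sets[measurable_cong]
  fix t :: real
  obtain p q where pq: "p \<in> \<rat>" "q \<in> \<rat>" "p < t" "t < q"
    using Rats_dense_in_real[of "t - 1" t] Rats_dense_in_real[of t "t + 1"] by auto
  have "exp (t * y) \<le> exp (p * y) + exp (q * y)" for y :: real
  proof (cases "y \<ge> 0")
    case True
    then have "exp (t * y) \<le> exp (q * y)" using pq by (simp add: mult_right_mono)
    then show ?thesis by (simp add: add_increasing)
  next
    case False
    then have "exp (t * y) \<le> exp (p * y)" using pq by (simp add: mult_right_mono_neg)
    then show ?thesis by (simp add: add_increasing2)
  qed
  then have "exp_moment \<mu> t \<le> (\<integral>\<^sup>+y. ennreal (exp (p * y)) + ennreal (exp (q * y)) \<partial>\<mu>)"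
    unfolding exp_moment_def by (intro nn_integral_mono) (simp flip: ennreal_plus)
  also have "\<dots> = exp_moment \<mu> p + exp_moment \<mu> q" unfolding exp_moment_def by (simp add: nn_integral_add)
  also have "\<dots> < \<infinity>" using rat pq by simp
  finally show "exp_moment \<mu> t < \<infinity>" .
  show "0 < exp_moment \<mu> t"
  proof (rule ccontr)
    assume "\<not> 0 < exp_moment \<mu> t"
    then have "AE y in \<mu>. ennreal (exp (t * y)) = 0"
      by (simp add: exp_moment_def nn_integral_0_iff_AE not_less)
    then have "AE y in \<mu>. ennreal (exp (0 * y)) = 0" by eventually_elim (simp add: ennreal_eq_0_iff)
    then have "exp_moment \<mu> 0 = (\<integral>\<^sup>+y. 0 \<partial>\<mu>)"
      unfolding exp_moment_def by (rule nn_integral_cong_AE)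
    then have "exp_moment \<mu> 0 = 0" by simp
    then show False using rat[of 0] by simp
  qed
qed

lemma sets_exp_moments_finite: "exp_moments_finite \<mu> \<Longrightarrow> sets \<mu> = sets borel"
  by (simp add: exp_moments_finite_def)

text \<open>This is Hoelder's inequality. It is obtained by applying convexity of exp pointwise to
  the normalised exponents a y - L(a) and b y - L(b), whose exponentials have integral one, and
  integrating.\<close>

lemma convex_log_moment:
  assumes \<mu>: "exp_moments_finite \<mu>"
  shows "convex_on UNIV (log_moment \<mu>)"
proof (rule convex_onI)
  note sets_exp_moments_finite[OF \<mu>, measurable_cong]
  fix u a b :: real
  assume u: "0 < u" "u < 1"
  let ?L = "log_moment \<mu>"
  let ?t = "(1 - u) * a + u * b" and ?c = "(1 - u) * ?L a + u * ?L b"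
  have cancel: "K * (1 - u) * exp (- A) * exp A + K * u * exp (- B) * exp B = K" for K A B :: real
    by (simp add: exp_minus field_simps)
  have "exp (?t * y) \<le> (exp ?c * (1 - u) * exp (- ?L a)) * exp (a * y) + (exp ?c * u * exp (- ?L b)) * exp (b * y)" for y
  proof -
    have "exp ((1 - u) * (a * y - ?L a) + u * (b * y - ?L b)) \<le> (1 - u) * exp (a * y - ?L a) + u * exp (b * y - ?L b)"
      using convex_onD[OF exp_convex, of u "a * y - ?L a" "b * y - ?L b"] u by simp
    then have "exp ?c * exp ((1 - u) * (a * y - ?L a) + u * (b * y - ?L b)) \<le> exp ?c * ((1 - u) * exp (a * y - ?L a) + u * exp (b * y - ?L b))"
      by (intro mult_left_mono) auto
    moreover have "exp ?c * exp ((1 - u) * (a * y - ?L a) + u * (b * y - ?L b)) = exp (?t * y)"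
      by (simp flip: exp_add add: algebra_simps)
    ultimately show ?thesis by (simp add: algebra_simps exp_diff exp_minus divide_inverse)
  qed
  then have "exp_moment \<mu> ?t \<le> (\<integral>\<^sup>+y. ennreal (exp ?c * (1 - u) * exp (- ?L a)) * ennreal (exp (a * y)) + ennreal (exp ?c * u * exp (- ?L b)) * ennreal (exp (b * y)) \<partial>\<mu>)"
    unfolding exp_moment_def using u
    by (intro nn_integral_mono) (simp flip: ennreal_plus ennreal_mult del: ennreal_plus)
  also have "\<dots> = ennreal (exp ?c * (1 - u) * exp (- ?L a)) * exp_moment \<mu> a + ennreal (exp ?c * u * exp (- ?L b)) * exp_moment \<mu> b"
    unfolding exp_moment_def by (simp add: nn_integral_add nn_integral_cmult)
  also have "\<dots> = ennreal (exp ?c)"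
    using cancel[of "exp ?c" "?L a" "?L b"]
    unfolding exp_moment_eq[OF \<mu>] using u
    by (simp flip: ennreal_plus ennreal_mult del: ennreal_plus)
  finally have "exp (?L ?t) \<le> exp ?c" unfolding exp_moment_eq[OF \<mu>] by simp
  then show "log_moment \<mu> ((1 - u) *\<^sub>R a + u *\<^sub>R b) \<le> (1 - u) * ?L a + u * ?L b" by simp
qed simp

text \<open>Both sides are even in \<open>z\<close>, and for z \<ge> 0 the left side equals exp(z)
  (1 - exp(-z))^2 with 0 \<le> 1 - exp(-z) \<le> z.\<close>

lemma exp_second_difference:
  fixes z :: real
  shows "exp z + exp (- z) - 2 \<le> z\<^sup>2 * exp \<bar>z\<bar>"
proof -
  have *: "exp z + exp (- z) - 2 \<le> z\<^sup>2 * exp z" if z: "z \<ge> 0" for z :: real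
  proof -
    have "(1 - exp (- z))\<^sup>2 \<le> z\<^sup>2"
      using z exp_ge_add_one_self[of "- z"] by (intro power_mono) auto
    then have "exp z * (1 - exp (- z))\<^sup>2 \<le> exp z * z\<^sup>2" by (intro mult_left_mono) auto
    moreover have "exp z * (1 - exp (- z))\<^sup>2 = exp z + exp (- z) - 2"
      by (simp add: power2_eq_square field_simps exp_minus)
    ultimately show ?thesis by (simp add: mult.commute)
  qed
  show ?thesis using *[of z] *[of "- z"] by (cases "z \<ge> 0") (simp_all add: add.commute)
qed

text \<open>Stands in for a bound on the second derivative. With m = exp L, the sum m(t+h) + m(t-h)
  exceeds 2 m(t) by at most a multiple of h^2, and the inequality of arithmetic and geometric means
  passes this on to the product, hence to the logarithms.\<close>

lemma log_moment_second_difference: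
  assumes \<mu>: "exp_moments_finite \<mu>"
  obtains C where "\<And>h. 0 \<le> h \<Longrightarrow> h \<le> 1 \<Longrightarrow>
    log_moment \<mu> (t + h) + log_moment \<mu> (t - h) - 2 * log_moment \<mu> t \<le> C * h\<^sup>2"
proof
  note sets_exp_moments_finite[OF \<mu>, measurable_cong]
  let ?L = "log_moment \<mu>"
  define m where "m s = exp (?L s)" for s
  have m: "exp_moment \<mu> s = ennreal (m s)" "m s > 0" for s
    using exp_moment_eq[OF \<mu>] by (simp_all add: m_def)
  fix h :: real assume h: "0 \<le> h" "h \<le> 1"
  have "exp ((t + h) * y) + exp ((t - h) * y) \<le> 2 * exp (t * y) + (2 * h\<^sup>2) * exp ((t + 2) * y) + (2 * h\<^sup>2) * exp ((t - 2) * y)" for y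
  proof -
    \<comment> \<open>One factor exp|y| absorbs y^2, the other dominates exp|hy| because h \<le> 1.
      Their product exp(2|y|) explains the shifts by 2 in the bound.\<close>
    have "\<bar>h * y\<bar> \<le> \<bar>y\<bar>" using h by (simp add: abs_mult mult_left_le_one_le)
    have "1 + \<bar>y\<bar> + \<bar>y\<bar>\<^sup>2 / 2 \<le> exp \<bar>y\<bar>" by (rule exp_lower_Taylor_quadratic) simp
    then have y2: "y\<^sup>2 \<le> 2 * exp \<bar>y\<bar>" by simp
    have "exp (h * y) + exp (- (h * y)) - 2 \<le> (h * y)\<^sup>2 * exp \<bar>h * y\<bar>" by (rule exp_second_difference)
    also have "\<dots> \<le> (h\<^sup>2 * (2 * exp \<bar>y\<bar>)) * exp \<bar>y\<bar>"
      unfolding power_mult_distrib using y2 \<open>\<bar>h * y\<bar> \<le> \<bar>y\<bar>\<close> by (intro mult_mono) auto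
    also have "\<dots> = 2 * h\<^sup>2 * exp (2 * \<bar>y\<bar>)" by (simp add: exp_double power2_eq_square)
    also have "\<dots> \<le> 2 * h\<^sup>2 * (exp (2 * y) + exp (- 2 * y))" by (intro mult_left_mono) (auto simp: abs_if)
    finally have "exp (t * y) * (exp (h * y) + exp (- (h * y)) - 2) \<le> exp (t * y) * (2 * h\<^sup>2 * (exp (2 * y) + exp (- 2 * y)))"
      by (intro mult_left_mono) auto
    moreover have "E * A + E * B \<le> 2 * E + c * (E * P) + c * (E * Q)" if "E * (A + B - 2) \<le> E * (c * (P + Q))"
      for E A B c P Q :: real using that by (simp add: algebra_simps)
    ultimately have "exp (t * y) * exp (h * y) + exp (t * y) * exp (- (h * y)) \<le>
        2 * exp (t * y) + 2 * h\<^sup>2 * (exp (t * y) * exp (2 * y)) + 2 * h\<^sup>2 * (exp (t * y) * exp (- 2 * y))"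
      by blast
    moreover have "exp (t * y) * exp (h * y) = exp ((t + h) * y)" "exp (t * y) * exp (- (h * y)) = exp ((t - h) * y)"
      "exp (t * y) * exp (2 * y) = exp ((t + 2) * y)" "exp (t * y) * exp (- 2 * y) = exp ((t - 2) * y)"
      by (simp_all flip: exp_add add: algebra_simps)
    ultimately show ?thesis by (simp only:)
  qed
  then have "(\<integral>\<^sup>+y. ennreal (exp ((t + h) * y)) + ennreal (exp ((t - h) * y)) \<partial>\<mu>) \<le>
     (\<integral>\<^sup>+y. ennreal 2 * ennreal (exp (t * y)) + ennreal (2 * h\<^sup>2) * ennreal (exp ((t + 2) * y)) + ennreal (2 * h\<^sup>2) * ennreal (exp ((t - 2) * y)) \<partial>\<mu>)"
    by (intro nn_integral_mono) (simp flip: ennreal_plus ennreal_mult del: ennreal_plus ennreal_numeral)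
  then have "exp_moment \<mu> (t + h) + exp_moment \<mu> (t - h) \<le>
      ennreal 2 * exp_moment \<mu> t + ennreal (2 * h\<^sup>2) * exp_moment \<mu> (t + 2) + ennreal (2 * h\<^sup>2) * exp_moment \<mu> (t - 2)"
    unfolding exp_moment_def by (simp add: nn_integral_add nn_integral_cmult)
  then have "m (t + h) + m (t - h) \<le> 2 * m t + 2 * h\<^sup>2 * m (t + 2) + 2 * h\<^sup>2 * m (t - 2)"
    unfolding m using m(2) by (simp flip: ennreal_plus ennreal_mult del: ennreal_plus ennreal_numeral add: less_imp_le)
  also have "\<dots> = 2 * (m t * (1 + (m (t + 2) + m (t - 2)) / m t * h\<^sup>2))"
    using m(2)[of t] by (simp add: field_simps)
  also have "\<dots> \<le> 2 * (m t * exp ((m (t + 2) + m (t - 2)) / m t * h\<^sup>2))"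
    using m(2)[of t] exp_ge_add_one_self by (intro mult_left_mono) auto
  finally have *: "(m (t + h) + m (t - h)) / 2 \<le> m t * exp ((m (t + 2) + m (t - 2)) / m t * h\<^sup>2)" by simp
  have "m (t + h) * m (t - h) \<le> ((m (t + h) + m (t - h)) / 2)\<^sup>2"
    using zero_le_power2[of "m (t + h) - m (t - h)"] by (simp add: power2_eq_square field_simps)
  also have "\<dots> \<le> (m t * exp ((m (t + 2) + m (t - 2)) / m t * h\<^sup>2))\<^sup>2"
    using * m(2) by (intro power_mono) (simp_all add: less_imp_le add_nonneg_nonneg)
  also have "\<dots> = exp (2 * ?L t + 2 * ((m (t + 2) + m (t - 2)) / m t) * h\<^sup>2)"
    unfolding m_def[of t] exp_add[symmetric] exp_double[symmetric] by (simp add: algebra_simps)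
  finally have "exp (?L (t + h) + ?L (t - h)) \<le> exp (2 * ?L t + 2 * ((m (t + 2) + m (t - 2)) / m t) * h\<^sup>2)"
    by (simp add: m_def exp_add)
  then show "?L (t + h) + ?L (t - h) - 2 * ?L t \<le> 2 * ((m (t + 2) + m (t - 2)) / m t) * h\<^sup>2" by simp
qed

lemma isCont_neighbourhood_greater:
  fixes h :: "real \<Rightarrow> real"
  assumes "isCont h t" "a < h t"
  obtains d where "d > 0" "\<And>x. \<bar>x - t\<bar> < d \<Longrightarrow> a < h x"
proof -
  have "\<forall>\<^sub>F x in nhds t. a < h x"
    using assms by (intro order_tendstoD(1)[of h "h t"]) (auto simp: isCont_def tendsto_nhds_iff)
  then show ?thesis using that by (auto simp: eventually_nhds_metric dist_real_def)
qed

text \<open>From above, f n t is at most the larger value at two rationals around \<open>t\<close>.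
  From below, convexity keeps f n t above the chord through rationals p < q < t extended to
  \<open>t\<close>; its limit is close to g t when \<open>q\<close> is close to
  \<open>t\<close>.\<close>

lemma convex_pointwise_limit:
  fixes f :: "nat \<Rightarrow> real \<Rightarrow> real"
  assumes f: "\<And>n. convex_on UNIV (f n)" and g: "convex_on UNIV g"
    and lim: "\<And>q. q \<in> \<rat> \<Longrightarrow> (\<lambda>n. f n q) \<longlonglongrightarrow> g q"
  shows "(\<lambda>n. f n t) \<longlonglongrightarrow> g t"
proof (rule order_tendstoI)
  have "continuous_on UNIV g" by (rule convex_on_continuous) (use g in auto)
  then have cont: "isCont g t" by (simp add: continuous_on_eq_continuous_at)
  have rats: "\<exists>q\<in>\<rat>. x < q \<and> q < y" if "x < y" for x y :: real
    using Rats_dense_in_real[OF that] by blast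
  {
    fix a assume a: "g t < a"
    then obtain d where d: "d > 0" "\<And>x. \<bar>x - t\<bar> < d \<Longrightarrow> g x < a"
      using isCont_neighbourhood_greater[of t "\<lambda>x. - g x" "- a"] cont by auto
    obtain p q where pq: "p \<in> \<rat>" "q \<in> \<rat>" "t - d < p" "p < t" "t < q" "q < t + d"
      using rats[of "t - d" t] rats[of t "t + d"] d by auto
    have "\<forall>\<^sub>F n in sequentially. f n p < a" "\<forall>\<^sub>F n in sequentially. f n q < a"
      using d(2)[of p] d(2)[of q] pq lim by (auto intro!: order_tendstoD(2))
    then show "\<forall>\<^sub>F n in sequentially. f n t < a"
    proof eventually_elim
      case (elim n)
      have "f n t \<le> max (f n p) (f n q)"
        using convex_on_le_max[OF convex_on_subset[OF f[of n]], of p q t] pq by simp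
      then show ?case using elim by linarith
    qed
  }
  {
    fix a assume a: "a < g t"
    \<comment> \<open>Any rational below \<open>t\<close> would do. It stays fixed while
      \<open>q\<close> approaches \<open>t\<close>, so the chord slope has a finite limit and the
      correction (t - q) times the slope tends to zero.\<close>
    define p where "p = (of_int (\<lfloor>t\<rfloor> - 1) :: real)"
    have p: "p \<in> \<rat>" "p < t" unfolding p_def by (auto, linarith)
    have "isCont (\<lambda>x. g x + (t - x) * (g x - g p) / (x - p)) t"
      using p cont by (intro continuous_intros) auto
    moreover have "a < g t + (t - t) * (g t - g p) / (t - p)" using a by simp
    ultimately obtain d where d: "d > 0" "\<And>x. \<bar>x - t\<bar> < d \<Longrightarrow> a < g x + (t - x) * (g x - g p) / (x - p)"
      using isCont_neighbourhood_greater by blast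
    obtain q where q: "q \<in> \<rat>" "max p (t - d) < q" "q < t"
      using rats[of "max p (t - d)" t] d p by auto
    have "(\<lambda>n. f n q + (t - q) * (f n q - f n p) / (q - p)) \<longlonglongrightarrow> g q + (t - q) * (g q - g p) / (q - p)"
      using q p by (intro tendsto_intros lim) auto
    moreover have "a < g q + (t - q) * (g q - g p) / (q - p)" using d(2)[of q] q by auto
    ultimately have "\<forall>\<^sub>F n in sequentially. a < f n q + (t - q) * (f n q - f n p) / (q - p)"
      by (rule order_tendstoD)
    then show "\<forall>\<^sub>F n in sequentially. a < f n t"
    proof eventually_elim
      case (elim n)
      \<comment> \<open>The weight that writes \<open>q\<close> as a convex combination of
        \<open>p\<close> and \<open>t\<close>; solving the convexity inequality for
        \<open>f n t\<close> gives the extended chord.\<close>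
      define l where "l = (q - p) / (t - p)"
      have l: "0 < l" "l < 1" using q p by (auto simp: l_def field_simps)
      have q_eq: "(1 - l) * p + l * t = q" 
      proof -
        have "l * (t - p) = q - p" using p by (simp add: l_def)
        then show ?thesis by (simp add: algebra_simps)
      qed
      have "f n q \<le> (1 - l) * f n p + l * f n t"
        using convex_onD[OF f[of n], of l p t] l by (simp add: q_eq)
      then have "f n q + (1 - l) * (f n q - f n p) / l \<le> f n t"
        using l by (simp add: field_simps)
      moreover have "(t - q) / (q - p) = (1 - l) / l"
      proof -
        have "l * (t - p) = q - p" using p by (simp add: l_def)
        then have "t - q = (1 - l) * (t - p)" "q - p = l * (t - p)" by (simp_all add: algebra_simps)
        then show ?thesis using p by simp
      qed
      then have "(t - q) * (f n q - f n p) / (q - p) = (1 - l) * (f n q - f n p) / l"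
        by (metis times_divide_eq_left)
      ultimately have "f n q + (t - q) * (f n q - f n p) / (q - p) \<le> f n t" by simp
      then show ?case using elim by linarith
    qed
  }
qed

section \<open>The Gartner-Ellis theorem on the line\<close>

lemma elog_mono: "x \<le> y \<Longrightarrow> elog x \<le> elog y"
proof -
  assume xy: "x \<le> y"
  show ?thesis
  proof (cases "x = 0 \<or> y = \<top>")
    case False
    then have "0 < enn2real x" "enn2real x \<le> enn2real y" "x \<noteq> \<top>" "y \<noteq> 0"
      using xy by (auto simp: enn2real_positive_iff less_top top.not_eq_extremum top_unique zero_less_iff_neq_zero intro!: enn2real_mono)
    then show ?thesis using False by (auto simp: elog_def)
  qed (use xy in \<open>auto simp: elog_def\<close>)
qed

lemma scaled_elog_le:
  assumes "n \<ge> 1" "x \<le> ennreal (exp (real n * c))"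
  shows "ereal (1 / real n) * elog x \<le> ereal c"
proof -
  have "ereal (1 / real n) * elog x \<le> ereal (1 / real n) * ereal (real n * c)"
    using elog_mono[OF assms(2)] unfolding elog_exp by (intro ereal_mult_left_mono) auto
  then show ?thesis using assms(1) by simp
qed

lemma scaled_elog_ge:
  assumes "n \<ge> 1" "ennreal (exp (real n * c)) \<le> x"
  shows "ereal c \<le> ereal (1 / real n) * elog x"
proof -
  have "ereal (1 / real n) * ereal (real n * c) \<le> ereal (1 / real n) * elog x"
    using elog_mono[OF assms(2)] unfolding elog_exp by (intro ereal_mult_left_mono) auto
  then show ?thesis using assms(1) by simp
qed

text \<open>Lets a constant factor (a cardinality, 2 or 4) be absorbed by an arbitrarily small
  exponential rate.\<close>

lemma eventually_le_exp:
  fixes K c :: real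
  assumes "c > 0"
  shows "\<forall>\<^sub>F n in sequentially. K \<le> exp (real n * c)"
proof -
  obtain N :: nat where N: "real N > K / c" using reals_Archimedean2 by blast
  show ?thesis
  proof (rule eventually_sequentiallyI[of N])
    fix n assume "n \<ge> N"
    then have "K / c < real n" using N by linarith
    then have "K < real n * c" using assms by (simp add: pos_divide_less_eq)
    then show "K \<le> exp (real n * c)" using exp_ge_add_one_self[of "real n * c"] by linarith
  qed
qed

text \<open>Markov's inequality for exp(n (y t - b - \<alpha>)), which is at least 1 on the set. In
  the application \<open>l\<close> is \<open>L n t\<close> and \<open>b\<close> is its limit
  \<open>\<Lambda> t\<close>.\<close>

lemma chernoff_bound:
  assumes sets: "sets \<nu> = sets borel" and mom: "exp_moment \<nu> (real n * t) = ennreal (exp (real n * l))"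
  shows "emeasure \<nu> {y. y * t - b > \<alpha>} \<le> ennreal (exp (real n * (l - b - \<alpha>)))"
proof -
  note sets[measurable_cong]
  have "emeasure \<nu> {y. y * t - b > \<alpha>} = (\<integral>\<^sup>+y. indicator {y. y * t - b > \<alpha>} y \<partial>\<nu>)"
    by (rule nn_integral_indicator[symmetric]) (simp add: sets)
  also have "\<dots> \<le> (\<integral>\<^sup>+y. ennreal (exp (- real n * (b + \<alpha>))) * ennreal (exp (real n * t * y)) \<partial>\<nu>)"
  proof (intro nn_integral_mono)
    fix y
    have "0 \<le> real n * (y * t - b - \<alpha>)" if "y * t - b > \<alpha>" using that by simp
    then have "1 \<le> exp (real n * (y * t - b - \<alpha>))" if "y * t - b > \<alpha>" using that by simp
    moreover have "exp (- real n * (b + \<alpha>)) * exp (real n * t * y) = exp (real n * (y * t - b - \<alpha>))"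
      by (simp flip: exp_add add: algebra_simps)
    ultimately show "indicator {y. y * t - b > \<alpha>} y \<le> ennreal (exp (- real n * (b + \<alpha>))) * ennreal (exp (real n * t * y))"
      by (simp flip: ennreal_mult del: ennreal_1 add: indicator_def ennreal_1[symmetric])
  qed
  also have "\<dots> = ennreal (exp (- real n * (b + \<alpha>))) * exp_moment \<nu> (real n * t)"
    unfolding exp_moment_def by (rule nn_integral_cmult) simp
  also have "\<dots> = ennreal (exp (real n * (l - b - \<alpha>)))"
    unfolding mom by (simp flip: ennreal_mult exp_add add: algebra_simps)
  finally show ?thesis .
qed

lemma ereal_le_uminus_iff: "a \<le> - b \<longleftrightarrow> b \<le> - a" for a b :: ereal
  by (metis ereal_minus_le_minus ereal_uminus_uminus)

text \<open>For a level \<alpha> below the infimum, every point of the closure lies in an open set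
  \<open>U t\<close> whose mass the Chernoff bound controls. Compactness leaves finitely many
  \<open>t\<close> on a bounded part, and the tilts 1 and -1 cover the rest; this plays the part of
  exponential tightness.\<close>

lemma gartner_ellis_upper:
  fixes \<nu> :: "nat \<Rightarrow> real measure" and L :: "nat \<Rightarrow> real \<Rightarrow> real" and \<Lambda> :: "real \<Rightarrow> real"
  assumes sets: "\<And>n. n \<ge> 1 \<Longrightarrow> sets (\<nu> n) = sets borel"
    and mom: "\<And>n t. n \<ge> 1 \<Longrightarrow> exp_moment (\<nu> n) (real n * t) = ennreal (exp (real n * L n t))"
    and lim: "\<And>t. (\<lambda>n. L n t) \<longlonglongrightarrow> \<Lambda> t"
  shows "limsup (\<lambda>n. ereal (1 / real n) * elog (emeasure (\<nu> n) A))
    \<le> - (INF x\<in>closure A. SUP t. ereal (x * t - \<Lambda> t))"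
proof -
  let ?I = "INF x\<in>closure A. SUP t. ereal (x * t - \<Lambda> t)"
  let ?S = "limsup (\<lambda>n. ereal (1 / real n) * elog (emeasure (\<nu> n) A))"
  have bound: "?S \<le> ereal (- \<beta>)" if \<beta>: "ereal \<beta> < ?I" for \<beta>
  proof -
    obtain \<alpha> where \<alpha>: "ereal \<beta> < ereal \<alpha>" "ereal \<alpha> < ?I" using ereal_dense2[OF \<beta>] by blast
    define U where "U t = {y. y * t - \<Lambda> t > \<alpha>}" for t
    have open_U: "open (U t)" for t unfolding U_def by (intro open_Collect_less continuous_intros)
    have cover: "closure A \<subseteq> (\<Union>t. U t)"
    proof
      fix x assume "x \<in> closure A"
      then have "ereal \<alpha> < (SUP t. ereal (x * t - \<Lambda> t))" using \<alpha>(2) by (rule less_INF_D[rotated])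
      then show "x \<in> (\<Union>t. U t)" by (auto simp: less_SUP_iff U_def)
    qed
    \<comment> \<open>Large enough that y > R puts \<open>y\<close> in \<open>U 1\<close> and y < -R
      puts it in \<open>U (-1)\<close>.\<close>
    define R where "R = \<bar>\<alpha>\<bar> + \<bar>\<Lambda> 1\<bar> + \<bar>\<Lambda> (- 1)\<bar>"
    have "compact (closure A \<inter> {- R..R})" by (intro closed_Int_compact) auto
    then obtain D where D: "D \<subseteq> UNIV" "finite D" "closure A \<inter> {- R..R} \<subseteq> (\<Union>t\<in>D. U t)"
      by (rule compactE_image[where C = UNIV and f = U]) (use open_U cover in auto)
    define E where "E = insert 1 (insert (- 1) D)"
    have E: "finite E" using D by (simp add: E_def)
    have "A \<subseteq> (\<Union>t\<in>E. U t)"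
    proof
      fix y assume "y \<in> A"
      then have "y \<in> closure A" using closure_subset by blast
      consider "y > R" | "y < - R" | "y \<in> {- R..R}" by fastforce
      then show "y \<in> (\<Union>t\<in>E. U t)"
      proof cases
        case 1
        then have "y \<in> U 1" by (simp add: U_def R_def)
        then show ?thesis by (auto simp: E_def)
      next
        case 2
        then have "y \<in> U (- 1)" by (simp add: U_def R_def)
        then show ?thesis by (auto simp: E_def)
      next
        case 3
        then show ?thesis using D \<open>y \<in> closure A\<close> by (auto simp: E_def)
      qed
    qed
    \<comment> \<open>Half of the gap pays for replacing \<open>L n t\<close> by its limit, the
      other half for the cardinality of the cover.\<close>
    define c where "c = (\<alpha> - \<beta>) / 2"
    have c: "c > 0" using \<alpha> by (simp add: c_def)
    have "\<forall>\<^sub>F n in sequentially. \<forall>t\<in>E. L n t < \<Lambda> t + c"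
      using c by (intro eventually_ball_finite E ballI order_tendstoD(2)[OF lim]) simp
    moreover have "\<forall>\<^sub>F n in sequentially. real (card E) \<le> exp (real n * c)"
      by (rule eventually_le_exp[OF c])
    ultimately have "\<forall>\<^sub>F n in sequentially. ereal (1 / real n) * elog (emeasure (\<nu> n) A) \<le> ereal (- \<beta>)"
      using eventually_ge_at_top[of 1]
    proof eventually_elim
      case (elim n)
      have U_sets: "U t \<in> sets (\<nu> n)" for t using open_U elim sets by simp
      have "emeasure (\<nu> n) A \<le> emeasure (\<nu> n) (\<Union>t\<in>E. U t)"
        using \<open>A \<subseteq> _\<close> E U_sets by (intro emeasure_mono) auto
      also have "\<dots> \<le> (\<Sum>t\<in>E. emeasure (\<nu> n) (U t))"
        using E U_sets by (intro emeasure_subadditive_finite) auto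
      also have "\<dots> \<le> (\<Sum>t\<in>E. ennreal (exp (real n * (c - \<alpha>))))"
      proof (rule sum_mono)
        fix t assume "t \<in> E"
        have "emeasure (\<nu> n) (U t) \<le> ennreal (exp (real n * (L n t - \<Lambda> t - \<alpha>)))"
          unfolding U_def using elim by (intro chernoff_bound sets mom)
        also have "\<dots> \<le> ennreal (exp (real n * (c - \<alpha>)))"
          using elim(1) \<open>t \<in> E\<close> by (intro ennreal_leI) (force intro!: mult_left_mono)
        finally show "emeasure (\<nu> n) (U t) \<le> ennreal (exp (real n * (c - \<alpha>)))" .
      qed
      also have "\<dots> = ennreal (real (card E) * exp (real n * (c - \<alpha>)))"
        by (simp add: ennreal_mult ennreal_of_nat_eq_real_of_nat)
      also have "\<dots> \<le> ennreal (exp (real n * c) * exp (real n * (c - \<alpha>)))"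
        using elim by (intro ennreal_leI mult_right_mono) auto
      also have "\<dots> = ennreal (exp (real n * (- \<beta>)))"
        by (simp flip: exp_add add: c_def field_simps)
      finally show ?case by (rule scaled_elog_le[rotated]) (use elim in simp)
    qed
    then show ?thesis by (rule Limsup_bounded)
  qed
  \<comment> \<open>Approximation from below also handles an infinite infimum.\<close>
  have "?I \<le> - ?S"
  proof (rule dense_le)
    fix z assume z: "z < ?I"
    show "z \<le> - ?S"
    proof (cases z)
      case (real \<beta>)
      then have "?S \<le> - z" using bound z by simp
      then show ?thesis by (subst ereal_le_uminus_iff)
    qed (use z in auto)
  qed
  then show ?thesis by (subst ereal_le_uminus_iff)
qed

text \<open>The measure with density exp(n t z) has mass exp(n l). Tilting further by s and -s
  bounds its mass on each side of the interval by exp(n (l - c)), at most a quarter of the total. At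
  least half remains inside, where the density is at most exp(n (t y + |t| \<delta>)). The tilted
  measure itself is never formed.\<close>

lemma tilted_lower_bound:
  assumes sets: "sets \<nu> = sets borel"
    and mom: "exp_moment \<nu> (real n * t) = ennreal (exp (real n * l))"
      "exp_moment \<nu> (real n * (t + s)) = ennreal (exp (real n * l1))"
      "exp_moment \<nu> (real n * (t - s)) = ennreal (exp (real n * l2))"
    and s: "s > 0"
    and c1: "l1 - l - s * (y + \<delta>) \<le> - c" and c2: "l2 - l + s * (y - \<delta>) \<le> - c"
    and n: "4 \<le> exp (real n * c)"
  shows "ennreal (exp (real n * (l - t * y - \<bar>t\<bar> * \<delta>)) / 2) \<le> emeasure \<nu> {y - \<delta><..<y + \<delta>}"
proof (cases "emeasure \<nu> {y - \<delta><..<y + \<delta>} = \<top>")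
  case False
  then obtain v where v: "emeasure \<nu> {y - \<delta><..<y + \<delta>} = ennreal v" "v \<ge> 0"
    by (cases "emeasure \<nu> {y - \<delta><..<y + \<delta>}") auto
  note sets[measurable_cong]
  let ?J = "{y - \<delta><..<y + \<delta>}"
  let ?a = "exp (real n * (t * y + \<bar>t\<bar> * \<delta>))" and ?b1 = "exp (- (real n * s * (y + \<delta>)))" and ?b2 = "exp (real n * s * (y - \<delta>))"
  \<comment> \<open>Each of the three terms dominates on its own region: inside, to the right of,
    and to the left of the interval.\<close>
  have pw: "exp (real n * t * z) \<le> ?a * indicator ?J z + ?b1 * exp (real n * (t + s) * z) + ?b2 * exp (real n * (t - s) * z)" for z
  proof -
    consider "z \<in> ?J" | "z \<ge> y + \<delta>" | "z \<le> y - \<delta>" by fastforce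
    then show ?thesis
    proof cases
      case 1
      then have "\<bar>z - y\<bar> \<le> \<delta>" by auto
      then have "\<bar>t\<bar> * \<bar>z - y\<bar> \<le> \<bar>t\<bar> * \<delta>" by (intro mult_left_mono) auto
      then have "t * (z - y) \<le> \<bar>t\<bar> * \<delta>" using abs_ge_self[of "t * (z - y)"] by (simp add: abs_mult)
      then have "real n * (t * z) \<le> real n * (t * y + \<bar>t\<bar> * \<delta>)" by (intro mult_left_mono) (auto simp: algebra_simps)
      then have "exp (real n * t * z) \<le> ?a" by (simp add: mult.assoc)
      then show ?thesis using 1 by (simp add: add_increasing2)
    next
      case 2
      then have "0 \<le> real n * s * (z - (y + \<delta>))" using s by simp
      then have "real n * t * z \<le> - (real n * s * (y + \<delta>)) + real n * (t + s) * z" by (simp add: algebra_simps)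
      then have "exp (real n * t * z) \<le> ?b1 * exp (real n * (t + s) * z)" by (simp flip: exp_add)
      then show ?thesis by (simp add: add_increasing add_increasing2 indicator_def)
    next
      case 3
      then have "0 \<le> real n * s * (y - \<delta> - z)" using s by simp
      then have "real n * t * z \<le> real n * s * (y - \<delta>) + real n * (t - s) * z" by (simp add: algebra_simps)
      then have "exp (real n * t * z) \<le> ?b2 * exp (real n * (t - s) * z)" by (simp flip: exp_add)
      then show ?thesis by (simp add: add_increasing add_increasing2 indicator_def)
    qed
  qed
  have "(\<integral>\<^sup>+z. ennreal (exp (real n * t * z)) \<partial>\<nu>) \<le>
     (\<integral>\<^sup>+z. ennreal ?a * indicator ?J z + ennreal ?b1 * ennreal (exp (real n * (t + s) * z)) + ennreal ?b2 * ennreal (exp (real n * (t - s) * z)) \<partial>\<nu>)"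
  proof (rule nn_integral_mono)
    fix z
    have "ennreal ?a * indicator ?J z = ennreal (?a * indicator ?J z)" by (simp add: indicator_def)
    then show "ennreal (exp (real n * t * z)) \<le> ennreal ?a * indicator ?J z + ennreal ?b1 * ennreal (exp (real n * (t + s) * z)) + ennreal ?b2 * ennreal (exp (real n * (t - s) * z))"
      using pw[of z] by (simp flip: ennreal_plus ennreal_mult del: ennreal_plus)
  qed
  also have "\<dots> = ennreal ?a * emeasure \<nu> ?J + ennreal ?b1 * exp_moment \<nu> (real n * (t + s)) + ennreal ?b2 * exp_moment \<nu> (real n * (t - s))"
    unfolding exp_moment_def by (simp add: nn_integral_add nn_integral_cmult sets)
  finally have "exp_moment \<nu> (real n * t) \<le> ennreal ?a * emeasure \<nu> ?J + ennreal ?b1 * exp_moment \<nu> (real n * (t + s)) + ennreal ?b2 * exp_moment \<nu> (real n * (t - s))"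
    unfolding exp_moment_def .
  then have *: "exp (real n * l) \<le> ?a * v + ?b1 * exp (real n * l1) + ?b2 * exp (real n * l2)"
    unfolding mom v(1) using v(2) by (simp flip: ennreal_plus ennreal_mult del: ennreal_plus)
  have small: "exp (real n * (l - c)) \<le> exp (real n * l) / 4"
    using n mult_left_mono[OF n, of "exp (real n * (l - c))"]
    by (simp flip: exp_add add: algebra_simps)
  have "?b1 * exp (real n * l1) = exp (real n * (l1 - s * (y + \<delta>)))" by (simp flip: exp_add add: algebra_simps)
  also have "\<dots> \<le> exp (real n * (l - c))" using c1 by (simp add: mult_left_mono)
  finally have 1: "?b1 * exp (real n * l1) \<le> exp (real n * l) / 4" using small by linarith
  have "?b2 * exp (real n * l2) = exp (real n * (l2 + s * (y - \<delta>)))" by (simp flip: exp_add add: algebra_simps)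
  also have "\<dots> \<le> exp (real n * (l - c))" using c2 by (simp add: mult_left_mono)
  finally have 2: "?b2 * exp (real n * l2) \<le> exp (real n * l) / 4" using small by linarith
  have "exp (real n * l) / 2 \<le> ?a * v" using * 1 2 by linarith
  then have "exp (- (real n * (t * y + \<bar>t\<bar> * \<delta>))) * (exp (real n * l) / 2) \<le> exp (- (real n * (t * y + \<bar>t\<bar> * \<delta>))) * (?a * v)"
    by (intro mult_left_mono) auto
  also have "\<dots> = v" by (simp add: exp_minus)
  also have "exp (- (real n * (t * y + \<bar>t\<bar> * \<delta>))) * (exp (real n * l) / 2) = exp (real n * (l - t * y - \<bar>t\<bar> * \<delta>)) / 2"
    by (simp flip: exp_add add: algebra_simps)
  finally show ?thesis unfolding v(1) by (rule ennreal_leI)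
qed simp

text \<open>The quadratic penalty makes the maximum of \<open>t \<mapsto> x t - \<Lambda> t\<close> attained, at the price of
  moving the slope from \<open>x\<close> to a nearby \<open>y\<close>; this avoids discussing whether \<open>x\<close> is exposed.\<close>

lemma approximate_exposed_point:
  fixes \<Lambda> :: "real \<Rightarrow> real"
  assumes cont: "continuous_on UNIV \<Lambda>"
    and bound: "\<And>t. x * t - \<Lambda> t \<le> C" and d: "d > 0"
  obtains t y \<epsilon> where "\<bar>y - x\<bar> < d" "t * y - \<Lambda> t \<le> C" "\<epsilon> > 0" "\<And>s. \<Lambda> (t + s) - \<Lambda> t \<ge> s * y - \<epsilon> * s\<^sup>2"
proof -
  define B where "B = C + \<Lambda> 0"
  have B: "B \<ge> 0" using bound[of 0] by (simp add: B_def)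
  \<comment> \<open>Comparing the maximiser \<open>t\<close> with 0 gives \<epsilon> t^2 \<le> B, so
    the slope moves by |2 \<epsilon> t| \<le> 2 sqrt(\<epsilon> B) < d.\<close>
  define \<epsilon> where "\<epsilon> = d\<^sup>2 / (4 * (B + 1))"
  have \<epsilon>: "\<epsilon> > 0" using d B by (simp add: \<epsilon>_def)
  define h where "h t = x * t - \<Lambda> t - \<epsilon> * t\<^sup>2" for t
  \<comment> \<open>Beyond \<open>R\<close> the penalty exceeds \<open>B\<close>, so
    \<open>h\<close> is at most \<open>h 0\<close> there and a maximum over the compact interval is
    global.\<close>
  define R where "R = sqrt (B / \<epsilon>)"
  have R: "R \<ge> 0" "\<epsilon> * R\<^sup>2 = B" using B \<epsilon> by (simp_all add: R_def)
  have "continuous_on {- R..R} h"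
    unfolding h_def by (intro continuous_intros continuous_on_subset[OF cont]) auto
  then obtain t where t: "t \<in> {- R..R}" "\<And>u. u \<in> {- R..R} \<Longrightarrow> h u \<le> h t"
    using continuous_attains_sup[of "{- R..R}" h] R by auto
  have h0: "h 0 \<le> h t" using t R by simp
  have max: "h u \<le> h t" for u
  proof (cases "u \<in> {- R..R}")
    case False
    then have "R\<^sup>2 \<le> u\<^sup>2" using R by (simp add: abs_le_square_iff[symmetric]) linarith
    then have "B \<le> \<epsilon> * u\<^sup>2" using \<epsilon> R by (metis mult_left_mono less_imp_le)
    then have "h u \<le> h 0" using bound[of u] by (simp add: h_def B_def)
    then show ?thesis using h0 by simp
  qed (use t in auto)
  \<comment> \<open>The derivative of x t - \<epsilon> t^2 at the maximiser. With this slope,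
    \<open>h (t + s) \<le> h t\<close> rearranges to the claimed quadratic lower bound.\<close>
  define y where "y = x - 2 * \<epsilon> * t"
  have "\<epsilon> * t\<^sup>2 \<le> B" using h0 bound[of t] by (simp add: h_def B_def)
  have "(y - x)\<^sup>2 = 4 * \<epsilon> * (\<epsilon> * t\<^sup>2)" by (simp add: y_def power2_eq_square)
  also have "\<dots> \<le> 4 * \<epsilon> * B" using \<epsilon> \<open>\<epsilon> * t\<^sup>2 \<le> B\<close> by (intro mult_left_mono) auto
  also have "\<dots> < d\<^sup>2" using d B by (simp add: \<epsilon>_def field_simps)
  finally have "\<bar>y - x\<bar> < d" using d by (simp add: abs_le_square_iff[symmetric] flip: not_le)
  moreover have "t * y - \<Lambda> t \<le> C"
  proof -
    have "t * y - \<Lambda> t = x * t - \<Lambda> t - 2 * (\<epsilon> * t\<^sup>2)" by (simp add: y_def power2_eq_square algebra_simps)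
    moreover have "0 \<le> \<epsilon> * t\<^sup>2" using \<epsilon> by simp
    ultimately show ?thesis using bound[of t] by linarith
  qed
  moreover have "\<Lambda> (t + s) - \<Lambda> t \<ge> s * y - \<epsilon> * s\<^sup>2" for s
    using max[of "t + s"] by (simp add: h_def y_def power2_eq_square algebra_simps)
  ultimately show ?thesis using that \<epsilon> by blast
qed

text \<open>Near \<open>x\<close> a slope \<open>y\<close> supports \<Lambda> at some
  \<open>t\<close> from below up to a quadratic error. Smoothness turns this into upper bounds on
  \<Lambda>(t + s) and \<Lambda>(t - s): both one-sided slopes lie within \<delta> of
  \<open>y\<close>. That makes both tails of the tilted measure exponentially small.\<close>

lemma gartner_ellis_lower:
  fixes \<nu> :: "nat \<Rightarrow> real measure" and L :: "nat \<Rightarrow> real \<Rightarrow> real" and \<Lambda> :: "real \<Rightarrow> real"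
  assumes sets: "\<And>n. n \<ge> 1 \<Longrightarrow> sets (\<nu> n) = sets borel"
    and mom: "\<And>n t. n \<ge> 1 \<Longrightarrow> exp_moment (\<nu> n) (real n * t) = ennreal (exp (real n * L n t))"
    and lim: "\<And>t. (\<lambda>n. L n t) \<longlonglongrightarrow> \<Lambda> t"
    and cont: "continuous_on UNIV \<Lambda>"
    and smooth: "\<And>t. (\<lambda>k. real (Suc k) * (\<Lambda> (t + 1 / Suc k) + \<Lambda> (t - 1 / Suc k) - 2 * \<Lambda> t)) \<longlonglongrightarrow> 0"
    and A: "A \<in> sets borel"
  shows "- (INF x\<in>interior A. SUP t. ereal (x * t - \<Lambda> t))
    \<le> liminf (\<lambda>n. ereal (1 / real n) * elog (emeasure (\<nu> n) A))"
proof -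
  let ?S = "liminf (\<lambda>n. ereal (1 / real n) * elog (emeasure (\<nu> n) A))"
  have "- ?S \<le> (SUP t. ereal (x * t - \<Lambda> t))" if x: "x \<in> interior A" for x
  proof (cases "(SUP t. ereal (x * t - \<Lambda> t))")
    case MInf
    then have "ereal (x * 0 - \<Lambda> 0) \<le> - \<infinity>" by (metis SUP_upper UNIV_I)
    then show ?thesis by simp
  next
    case (real C)
    have bound: "x * t - \<Lambda> t \<le> C" for t
      using SUP_upper[of t UNIV "\<lambda>t. ereal (x * t - \<Lambda> t)"] real by simp
    obtain d where d: "d > 0" "{x - d<..<x + d} \<subseteq> A"
      using x unfolding mem_interior by (auto simp: ball_eq_greaterThanLessThan)
    have "- ?S \<le> ereal C + ereal \<kappa>" if \<kappa>: "\<kappa> > 0" for \<kappa>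
    proof -
      obtain t y \<epsilon> where ty: "\<bar>y - x\<bar> < d / 2" "t * y - \<Lambda> t \<le> C" "\<epsilon> > 0"
        "\<And>s. \<Lambda> (t + s) - \<Lambda> t \<ge> s * y - \<epsilon> * s\<^sup>2"
        by (rule approximate_exposed_point[OF cont bound half_gt_zero[OF d(1)]]) (rule that)
      \<comment> \<open>Half of \<open>d\<close> keeps the interval around \<open>y\<close> inside
        \<open>A\<close>, as \<open>y\<close> is within d/2 of \<open>x\<close>. The second bound
        makes |t| \<delta> at most \<kappa>/2, with |t| + 1 to avoid division by zero.\<close>
      define \<delta> where "\<delta> = min (d / 2) (\<kappa> / (2 * (\<bar>t\<bar> + 1)))"
      have \<delta>: "\<delta> > 0" "\<delta> \<le> d / 2" unfolding \<delta>_def using d \<kappa> by (simp, intro min.cobounded1)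
      have "\<bar>t\<bar> * \<delta> \<le> (\<bar>t\<bar> + 1) * (\<kappa> / (2 * (\<bar>t\<bar> + 1)))"
        using \<delta> by (intro mult_mono) (auto simp: \<delta>_def)
      also have "\<dots> = \<kappa> / 2" by (simp add: field_simps)
      finally have t\<delta>: "\<bar>t\<bar> * \<delta> \<le> \<kappa> / 2" .
      have J: "{y - \<delta><..<y + \<delta>} \<subseteq> A" using d(2) \<delta> ty(1) by (force simp: abs_less_iff)
      have "\<forall>\<^sub>F k in sequentially. real (Suc k) * (\<Lambda> (t + 1 / Suc k) + \<Lambda> (t - 1 / Suc k) - 2 * \<Lambda> t) < \<delta> / 2"
        using \<delta> by (intro order_tendstoD(2)[OF smooth]) auto
      moreover have "\<forall>\<^sub>F k in sequentially. \<epsilon> * (1 / Suc k) < \<delta> / 2"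
      proof (rule order_tendstoD(2))
        show "(\<lambda>k. \<epsilon> * (1 / real (Suc k))) \<longlonglongrightarrow> \<epsilon> * 0"
          using LIMSEQ_inverse_real_of_nat by (intro tendsto_intros) (simp add: inverse_eq_divide)
      qed (use \<delta> in auto)
      ultimately have "\<forall>\<^sub>F k in sequentially. real (Suc k) * (\<Lambda> (t + 1 / Suc k) + \<Lambda> (t - 1 / Suc k) - 2 * \<Lambda> t) < \<delta> / 2 \<and> \<epsilon> * (1 / Suc k) < \<delta> / 2"
        by (rule eventually_conj)
      then obtain k where k: "real (Suc k) * (\<Lambda> (t + 1 / Suc k) + \<Lambda> (t - 1 / Suc k) - 2 * \<Lambda> t) < \<delta> / 2" "\<epsilon> * (1 / Suc k) < \<delta> / 2"
        by (auto simp: eventually_sequentially)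
      \<comment> \<open>At this step the second difference and the penalty \<epsilon> s^2 are each
        below s \<delta> / 2, so together they cost less than s \<delta>.\<close>
      define s where "s = 1 / real (Suc k)"
      have s: "s > 0" by (simp add: s_def)
      have "s * (real (Suc k) * (\<Lambda> (t + s) + \<Lambda> (t - s) - 2 * \<Lambda> t)) < s * (\<delta> / 2)"
        using k(1) s unfolding s_def[symmetric] by (intro mult_strict_left_mono)
      then have sym: "\<Lambda> (t + s) + \<Lambda> (t - s) - 2 * \<Lambda> t < s * (\<delta> / 2)"
        by (simp add: s_def)
      have "s * (\<epsilon> * s) < s * (\<delta> / 2)" using k(2) s unfolding s_def[symmetric] by (intro mult_strict_left_mono)
      then have \<epsilon>s: "\<epsilon> * s\<^sup>2 < s * (\<delta> / 2)" by (simp add: power2_eq_square mult_ac)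
      have slope1: "\<Lambda> (t + s) - \<Lambda> t < s * (y + \<delta>)"
        using sym \<epsilon>s ty(4)[of "- s"] by (simp add: algebra_simps)
      have slope2: "\<Lambda> (t - s) - \<Lambda> t < - s * (y - \<delta>)"
        using sym \<epsilon>s ty(4)[of s] by (simp add: algebra_simps)
      \<comment> \<open>Half of the smaller slope gap; the other half is slack for the convergence
        of \<open>L n\<close> to \<Lambda>.\<close>
      define c where "c = min (s * (y + \<delta>) - (\<Lambda> (t + s) - \<Lambda> t)) (- s * (y - \<delta>) - (\<Lambda> (t - s) - \<Lambda> t)) / 2"
      have c: "c > 0" using slope1 slope2 by (simp add: c_def)
      have "2 * c = min (s * (y + \<delta>) - (\<Lambda> (t + s) - \<Lambda> t)) (- s * (y - \<delta>) - (\<Lambda> (t - s) - \<Lambda> t))"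
        unfolding c_def mult_2 by (rule field_sum_of_halves)
      then have c_le: "2 * c \<le> s * (y + \<delta>) - (\<Lambda> (t + s) - \<Lambda> t)" "2 * c \<le> - s * (y - \<delta>) - (\<Lambda> (t - s) - \<Lambda> t)"
        by (simp_all only: min.cobounded1 min.cobounded2)
      have "\<forall>\<^sub>F n in sequentially. L n (t + s) - L n t - s * (y + \<delta>) < - c"
      proof (rule order_tendstoD(2))
        show "(\<lambda>n. L n (t + s) - L n t - s * (y + \<delta>)) \<longlonglongrightarrow> \<Lambda> (t + s) - \<Lambda> t - s * (y + \<delta>)"
          by (intro tendsto_intros lim)
        show "\<Lambda> (t + s) - \<Lambda> t - s * (y + \<delta>) < - c"
          using c c_le by linarith
      qed
      moreover have "\<forall>\<^sub>F n in sequentially. L n (t - s) - L n t + s * (y - \<delta>) < - c"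
      proof (rule order_tendstoD(2))
        show "(\<lambda>n. L n (t - s) - L n t + s * (y - \<delta>)) \<longlonglongrightarrow> \<Lambda> (t - s) - \<Lambda> t + s * (y - \<delta>)"
          by (intro tendsto_intros lim)
        show "\<Lambda> (t - s) - \<Lambda> t + s * (y - \<delta>) < - c"
          using c c_le by linarith
      qed
      moreover have "\<forall>\<^sub>F n in sequentially. L n t > \<Lambda> t - \<kappa> / 4"
        using \<kappa> by (intro order_tendstoD(1)[OF lim]) simp
      moreover have "\<forall>\<^sub>F n in sequentially. 4 \<le> exp (real n * c)" by (rule eventually_le_exp[OF c])
      moreover have "\<forall>\<^sub>F n in sequentially. 2 \<le> exp (real n * (\<kappa> / 4))" using \<kappa> by (intro eventually_le_exp) simp
      ultimately have "\<forall>\<^sub>F n in sequentially. ereal (- (C + \<kappa>)) \<le> ereal (1 / real n) * elog (emeasure (\<nu> n) A)"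
        using eventually_ge_at_top[of 1]
      proof eventually_elim
        case (elim n)
        have "ennreal (exp (real n * (L n t - t * y - \<bar>t\<bar> * \<delta>)) / 2) \<le> emeasure (\<nu> n) {y - \<delta><..<y + \<delta>}"
          using elim s by (intro tilted_lower_bound[where s = s and c = c and ?l1.0 = "L n (t + s)" and ?l2.0 = "L n (t - s)"] sets mom) auto
        also have "\<dots> \<le> emeasure (\<nu> n) A" using J A sets elim by (intro emeasure_mono) auto
        finally have low: "ennreal (exp (real n * (L n t - t * y - \<bar>t\<bar> * \<delta>)) / 2) \<le> emeasure (\<nu> n) A" .
        \<comment> \<open>Budget for \<kappa>: a quarter for \<open>L n t\<close>, a half for |t|
          \<delta>, and the last quarter absorbs the factor 1/2 of the tilted bound.\<close>
        have "- (C + \<kappa>) + \<kappa> / 4 \<le> L n t - t * y - \<bar>t\<bar> * \<delta>"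
          using elim(3) ty(2) t\<delta> by linarith
        then have "exp (real n * (- (C + \<kappa>) + \<kappa> / 4)) \<le> exp (real n * (L n t - t * y - \<bar>t\<bar> * \<delta>))"
          by (intro iffD2[OF exp_le_cancel_iff] mult_left_mono) simp_all
        moreover have "exp (real n * (- (C + \<kappa>) + \<kappa> / 4)) = exp (real n * (- (C + \<kappa>))) * exp (real n * (\<kappa> / 4))"
          by (simp only: distrib_left exp_add)
        moreover have "exp (real n * (- (C + \<kappa>))) * 2 \<le> exp (real n * (- (C + \<kappa>))) * exp (real n * (\<kappa> / 4))"
          using elim(5) by (intro mult_left_mono) auto
        ultimately have "exp (real n * (- (C + \<kappa>))) \<le> exp (real n * (L n t - t * y - \<bar>t\<bar> * \<delta>)) / 2" by linarith
        then have "ennreal (exp (real n * (- (C + \<kappa>)))) \<le> emeasure (\<nu> n) A"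
          using low by (rule order_trans[OF ennreal_leI])
        then show ?case by (rule scaled_elog_ge[rotated]) (use elim in simp)
      qed
      then have "ereal (- (C + \<kappa>)) \<le> ?S" by (rule Liminf_bounded)
      then show ?thesis by (subst ereal_uminus_le_reorder) simp
    qed
    then have "- ?S \<le> ereal C" by (rule ereal_le_epsilon2)
    then show ?thesis using real by simp
  qed simp
  then have "- ?S \<le> (INF x\<in>interior A. SUP t. ereal (x * t - \<Lambda> t))" by (intro INF_greatest)
  then show ?thesis by (subst ereal_uminus_le_reorder)
qed

section \<open>Intensity measures of the branching random walk\<close>

text \<open>Recursion on the word rather than on the generation makes measurability an induction on
  words and shows that only the vectors at strict ancestors matter.\<close>

primrec alive :: "(nat list \<Rightarrow> offspring) \<Rightarrow> nat list \<Rightarrow> bool" where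
  "alive x [] \<longleftrightarrow> True"
| "alive x (i # u) \<longleftrightarrow> alive x u \<and> i < fst (x u)"

lemma particles_eq: "particles x n = {u. length u = n \<and> alive x u}"
proof (induction n)
  case (Suc n)
  show ?case
  proof (rule set_eqI)
    fix u show "u \<in> particles x (Suc n) \<longleftrightarrow> u \<in> {u. length u = Suc n \<and> alive x u}"
      by (cases u) (auto simp: Suc)
  qed
qed auto

text \<open>Only words strictly shorter than \<open>u\<close> are consulted. With v = u this says
  that the existence of \<open>u\<close> does not involve its own offspring vector.\<close>

lemma alive_upd: "length u \<le> length v \<Longrightarrow> alive (x(v := z)) u = alive x u"
  by (induction u) auto

lemma position_upd: "length u \<le> length v \<Longrightarrow> position (x(v := z)) u = position x u"
  by (induction u) auto

text \<open>The mean counting measure, obtained as an image of a measure on pairs (word,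
  realization). It is therefore a measure by construction, and exchanging sum and expectation is
  Tonelli on the pair space.\<close>

definition intensity :: "('th \<Rightarrow> offspring measure) \<Rightarrow> (nat \<Rightarrow> 'th) \<Rightarrow> nat \<Rightarrow> real measure" where
  "intensity \<eta> e n = distr (density (count_space UNIV \<Otimes>\<^sub>M quenched_law \<eta> e) (\<lambda>(u, x). indicator (particles x n) u))
     borel (\<lambda>(u, x). position x u)"

definition offspring_moment :: "offspring measure \<Rightarrow> real \<Rightarrow> ennreal" where
  "offspring_moment \<mu> t = (\<integral>\<^sup>+z. (\<Sum>i<fst z. ennreal (exp (t * snd z i))) \<partial>\<mu>)"

section \<open>Measurability on the offspring space and independence of one coordinate\<close>

lemma measurable_offspring_count [measurable]: "fst \<in> offspring_space \<rightarrow>\<^sub>M count_space UNIV"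
  unfolding offspring_space_def by measurable

lemma measurable_offspring_displacement [measurable]: "(\<lambda>z. snd z i) \<in> borel_measurable offspring_space"
  unfolding offspring_space_def by measurable

lemma measurable_offspring_term:
  "(\<lambda>z. if i < fst z then ennreal (exp (t * snd z i)) else 0) \<in> borel_measurable offspring_space"
proof -
  have [measurable]: "Measurable.pred offspring_space (\<lambda>z. i < fst z)"
    by (rule measurable_compose[OF measurable_offspring_count]) simp
  show ?thesis
    by (intro measurable_If measurable_ennreal borel_measurable_exp borel_measurable_times measurable_offspring_displacement)
      (auto intro: measurable_compose[OF _ borel_measurable_exp])
qed

lemma measurable_offspring_sum:
  fixes f :: "nat \<Rightarrow> offspring \<Rightarrow> ennreal"
  assumes "\<And>i. f i \<in> borel_measurable offspring_space"
  shows "(\<lambda>z. \<Sum>i<fst z. f i z) \<in> borel_measurable offspring_space"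
  by (rule measurable_compose_countable[where f = "\<lambda>n z. \<Sum>i<n. f i z" and g = fst])
    (use assms in auto)

lemma measurable_count_space_pair:
  fixes f :: "'u::countable \<times> 'x \<Rightarrow> 'y"
  assumes "\<And>u. (\<lambda>x. f (u, x)) \<in> Q \<rightarrow>\<^sub>M N"
  shows "f \<in> count_space UNIV \<Otimes>\<^sub>M Q \<rightarrow>\<^sub>M N"
  by (rule measurable_pair_measure_countable1) (use assms in auto)

text \<open>Independence of the coordinate \<open>v\<close> from a functional that ignores it: the
  product measure splits into the factor at \<open>v\<close> and the product over the other
  indices.\<close>

lemma nn_integral_PiM_split:
  assumes M: "\<And>i. prob_space (M i)"
    and F [measurable]: "F \<in> borel_measurable (PiM UNIV M)" and h [measurable]: "h \<in> borel_measurable (M v)"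
    and indep: "\<And>x z. F (x(v := z)) = F x"
  shows "(\<integral>\<^sup>+x. F x * h (x v) \<partial>PiM UNIV M) = (\<integral>\<^sup>+x. F x \<partial>PiM UNIV M) * (\<integral>\<^sup>+z. h z \<partial>M v)"
proof -
  let ?P = "PiM (UNIV - {v}) M"
  interpret P: prob_space ?P by (intro prob_space_PiM M)
  interpret V: prob_space "M v" by (rule M)
  \<comment> \<open>The value at \<open>v\<close> is an arbitrary filler. As \<open>G\<close> does
    not involve the second factor, the formula below with that factor equal to 1 identifies
    \<open>G\<close> as the integral of \<open>F\<close>.\<close>
  define G where "G = (\<integral>\<^sup>+X. F (X(v := undefined)) \<partial>?P)"
  have upd: "(\<lambda>(z, X). X(v := z)) \<in> M v \<Otimes>\<^sub>M ?P \<rightarrow>\<^sub>M PiM UNIV M"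
    unfolding split_beta by (rule measurable_fun_upd[where J = "UNIV - {v}"]) auto
  have F_upd: "F (X(v := z)) = F (X(v := undefined))" for X z
    using indep[of "X(v := undefined)" z] by simp
  have *: "(\<integral>\<^sup>+x. F x * k (x v) \<partial>PiM UNIV M) = G * (\<integral>\<^sup>+z. k z \<partial>M v)"
    if [measurable]: "k \<in> borel_measurable (M v)" for k
  proof -
    have "distr (M v \<Otimes>\<^sub>M ?P) (PiM UNIV M) (\<lambda>(z, X). X(v := z)) = PiM UNIV M"
      using distr_pair_PiM_eq_PiM[of "UNIV - {v}" M v] M by (simp add: insert_UNIV)
    then have "(\<integral>\<^sup>+x. F x * k (x v) \<partial>PiM UNIV M) =
        (\<integral>\<^sup>+x. F x * k (x v) \<partial>distr (M v \<Otimes>\<^sub>M ?P) (PiM UNIV M) (\<lambda>(z, X). X(v := z)))" by simp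
    also have "\<dots> = (\<integral>\<^sup>+p. F ((snd p)(v := fst p)) * k (fst p) \<partial>(M v \<Otimes>\<^sub>M ?P))"
      by (subst nn_integral_distr[OF upd]) (auto simp: split_beta)
    also have "\<dots> = (\<integral>\<^sup>+z. \<integral>\<^sup>+X. F (X(v := z)) * k z \<partial>?P \<partial>M v)"
      using upd by (subst P.nn_integral_fst[symmetric]) (auto simp: split_beta)
    also have "\<dots> = (\<integral>\<^sup>+z. k z * G \<partial>M v)"
    proof (intro nn_integral_cong)
      fix z assume z: "z \<in> space (M v)"
      have [measurable]: "(\<lambda>X. F (X(v := z))) \<in> borel_measurable ?P"
        using z by (intro measurable_compose[OF _ F] measurable_fun_upd[where J = "UNIV - {v}"]) auto
      have "(\<integral>\<^sup>+X. F (X(v := z)) * k z \<partial>?P) = (\<integral>\<^sup>+X. F (X(v := z)) \<partial>?P) * k z"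
        by (rule nn_integral_multc) simp
      then show "(\<integral>\<^sup>+X. F (X(v := z)) * k z \<partial>?P) = k z * G"
        unfolding G_def F_upd[of _ z] by (simp add: mult.commute)
    qed
    also have "\<dots> = G * (\<integral>\<^sup>+z. k z \<partial>M v)" by (subst nn_integral_multc) (auto simp: mult.commute)
    finally show ?thesis .
  qed
  have "(\<integral>\<^sup>+x. F x \<partial>PiM UNIV M) = G"
    using *[of "\<lambda>_. 1"] by (simp add: V.emeasure_space_1)
  then show ?thesis using *[OF h] by simp
qed

locale quenched_environment =
  fixes \<eta> :: "'th \<Rightarrow> offspring measure" and e :: "nat \<Rightarrow> 'th"
  assumes prob_\<eta>: "\<And>k. prob_space (\<eta> (e k))" and sets_\<eta>: "\<And>k. sets (\<eta> (e k)) = sets offspring_space"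
begin

abbreviation "Q \<equiv> quenched_law \<eta> e"

lemma prob_space_Q: "prob_space Q"
  unfolding quenched_law_def by (intro prob_space_PiM prob_\<eta>)

lemma measurable_component_Q [measurable]: "(\<lambda>x. x u) \<in> Q \<rightarrow>\<^sub>M offspring_space"
proof -
  have "(\<lambda>x. x u) \<in> Q \<rightarrow>\<^sub>M \<eta> (e (length u))" unfolding quenched_law_def by simp
  then show ?thesis by (simp add: measurable_cong_sets[OF refl sets_\<eta>])
qed

lemma measurable_alive [measurable]: "Measurable.pred Q (\<lambda>x. alive x u)"
proof (induction u)
  case (Cons i u)
  note Cons[measurable]
  show ?case by simp
qed simp

lemma measurable_position [measurable]: "(\<lambda>x. position x u) \<in> borel_measurable Q"
proof (induction u)
  case (Cons i u)
  note Cons[measurable]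
  have [measurable]: "(\<lambda>x. snd (x u) i) \<in> borel_measurable Q"
    by (rule measurable_compose[OF measurable_component_Q measurable_offspring_displacement])
  show ?case by simp
qed simp

lemma indicator_particles: "indicator (particles x n) u = (if length u = n \<and> alive x u then 1 else 0)"
  by (simp add: particles_eq indicator_def)

lemma sets_intensity: "sets (intensity \<eta> e n) = sets borel"
  by (simp add: intensity_def)

lemma nn_integral_intensity:
  fixes f :: "real \<Rightarrow> ennreal"
  assumes [measurable]: "f \<in> borel_measurable borel"
  shows "(\<integral>\<^sup>+y. f y \<partial>intensity \<eta> e n) =
    (\<integral>\<^sup>+u. (\<integral>\<^sup>+x. indicator (particles x n) u * f (position x u) \<partial>Q) \<partial>count_space UNIV)"
proof -
  interpret Q: prob_space Q by (rule prob_space_Q)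
  have ind: "(\<lambda>(u, x). indicator (particles x n) u :: ennreal) \<in> borel_measurable (count_space UNIV \<Otimes>\<^sub>M Q)"
    unfolding indicator_particles by (rule measurable_count_space_pair) simp
  have pos: "(\<lambda>(u, x). position x u) \<in> borel_measurable (count_space UNIV \<Otimes>\<^sub>M Q)"
    by (rule measurable_count_space_pair) simp
  have fpos: "(\<lambda>p. f (case p of (u, x) \<Rightarrow> position x u)) \<in> borel_measurable (count_space UNIV \<Otimes>\<^sub>M Q)"
    by (rule measurable_compose[OF pos]) simp
  have "(\<integral>\<^sup>+y. f y \<partial>intensity \<eta> e n) = (\<integral>\<^sup>+p. (case p of (u, x) \<Rightarrow> indicator (particles x n) u) * f (case p of (u, x) \<Rightarrow> position x u) \<partial>(count_space UNIV \<Otimes>\<^sub>M Q))"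
    unfolding intensity_def
    by (subst nn_integral_distr) (use pos fpos ind in \<open>simp_all add: nn_integral_density\<close>)
  also have "\<dots> = (\<integral>\<^sup>+u. (\<integral>\<^sup>+x. indicator (particles x n) u * f (position x u) \<partial>Q) \<partial>count_space UNIV)"
    using ind fpos by (subst Q.nn_integral_fst[symmetric]) simp_all
  finally show ?thesis .
qed

text \<open>Summing over all words makes the index set the same for every \<open>x\<close>, as
  needed to exchange the sum with the expectation.\<close>

lemma emeasure_Z:
  assumes "B \<in> sets borel"
  shows "emeasure (Z x n) B = (\<integral>\<^sup>+u. indicator (particles x n) u * indicator B (position x u) \<partial>count_space UNIV)"
proof -
  have "emeasure (Z x n) B = (\<integral>\<^sup>+y. indicator B y \<partial>Z x n)"
    using assms by (simp add: Z_def)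
  also have "\<dots> = (\<integral>\<^sup>+u. indicator B (position x u) \<partial>count_space (particles x n))"
    unfolding Z_def using assms by (subst nn_integral_distr) auto
  also have "\<dots> = (\<integral>\<^sup>+u. indicator B (position x u) * indicator (particles x n) u \<partial>count_space UNIV)"
    by (rule nn_integral_count_space_indicator) simp
  finally show ?thesis by (simp add: mult.commute)
qed

lemma emeasure_intensity:
  assumes "B \<in> sets borel"
  shows "emeasure (intensity \<eta> e n) B = (\<integral>\<^sup>+x. emeasure (Z x n) B \<partial>Q)"
proof -
  have "emeasure (intensity \<eta> e n) B = (\<integral>\<^sup>+y. indicator B y \<partial>intensity \<eta> e n)"
    using assms by (simp add: sets_intensity)
  also have "\<dots> = (\<integral>\<^sup>+u. (\<integral>\<^sup>+x. indicator (particles x n) u * indicator B (position x u) \<partial>Q) \<partial>count_space UNIV)"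
    using assms by (intro nn_integral_intensity) simp
  also have "\<dots> = (\<integral>\<^sup>+x. (\<integral>\<^sup>+u. indicator (particles x n) u * indicator B (position x u) \<partial>count_space UNIV) \<partial>Q)"
    unfolding indicator_particles
    using assms by (intro nn_integral_count_space_nn_integral[symmetric]) auto
  finally show ?thesis using assms by (simp add: emeasure_Z)
qed

section \<open>Exponential moments of the intensity as products of offspring moments\<close>

lemma offspring_moment_eq:
  "offspring_moment (\<eta> (e k)) t =
    (\<integral>\<^sup>+i. (\<integral>\<^sup>+z. (if i < fst z then ennreal (exp (t * snd z i)) else 0) \<partial>\<eta> (e k)) \<partial>count_space UNIV)"
proof -
  note sets_\<eta>[measurable_cong]
  have "(\<Sum>i<fst z. ennreal (exp (t * snd z i))) =
      (\<integral>\<^sup>+i. (if i < fst z then ennreal (exp (t * snd z i)) else 0) \<partial>count_space UNIV)" for z :: offspring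
  proof -
    have "(\<Sum>i<fst z. ennreal (exp (t * snd z i))) = (\<integral>\<^sup>+i. ennreal (exp (t * snd z i)) \<partial>count_space {..<fst z})"
      by (simp add: nn_integral_count_space_finite)
    also have "\<dots> = (\<integral>\<^sup>+i. ennreal (exp (t * snd z i)) * indicator {..<fst z} i \<partial>count_space UNIV)"
      by (rule nn_integral_count_space_indicator) simp
    also have "\<dots> = (\<integral>\<^sup>+i. (if i < fst z then ennreal (exp (t * snd z i)) else 0) \<partial>count_space UNIV)"
      by (intro nn_integral_cong) (simp add: indicator_def)
    finally show ?thesis .
  qed
  then show ?thesis unfolding offspring_moment_def
    by (simp only:) (intro nn_integral_count_space_nn_integral, simp_all add: measurable_offspring_term measurable_cong_sets[OF sets_\<eta> refl])
qed

text \<open>The weight of a child is the weight of its parent \<open>v\<close>, which ignores the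
  vector at \<open>v\<close>, times a function of that vector alone. Independence factorises the
  mean, and summing over the child number yields the offspring moment of generation
  \<open>n\<close>.\<close>

lemma exp_moment_intensity_Suc:
  "exp_moment (intensity \<eta> e (Suc n)) t = exp_moment (intensity \<eta> e n) t * offspring_moment (\<eta> (e n)) t"
proof -
  note sets_\<eta>[measurable_cong]
  define a where "a m u = (\<integral>\<^sup>+x. indicator (particles x m) u * ennreal (exp (t * position x u)) \<partial>Q)" for m u
  define w where "w i = (\<integral>\<^sup>+z. (if i < fst z then ennreal (exp (t * snd z i)) else 0) \<partial>\<eta> (e n))" for i
  have moment: "exp_moment (intensity \<eta> e m) t = (\<integral>\<^sup>+u. a m u \<partial>count_space UNIV)" for m
    unfolding exp_moment_def a_def by (rule nn_integral_intensity) simp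
  have step: "a (Suc n) (i # v) = a n v * w i" for i v
  proof (cases "length v = n")
    case True
    have "a (Suc n) (i # v) = (\<integral>\<^sup>+x. (indicator (particles x n) v * ennreal (exp (t * position x v))) *
        (if i < fst (x v) then ennreal (exp (t * snd (x v) i)) else 0) \<partial>Q)"
      unfolding a_def by (intro nn_integral_cong) (auto simp: indicator_particles distrib_left exp_add ennreal_mult simp del: particles.simps)
    also have "\<dots> = a n v * (\<integral>\<^sup>+z. (if i < fst z then ennreal (exp (t * snd z i)) else 0) \<partial>\<eta> (e (length v)))"
      unfolding a_def quenched_law_def
    proof (rule nn_integral_PiM_split)
      show "(\<lambda>x. indicator (particles x n) v * ennreal (exp (t * position x v))) \<in> borel_measurable (\<Pi>\<^sub>M u\<in>UNIV. \<eta> (e (length u)))"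
        unfolding quenched_law_def[symmetric] indicator_particles by measurable
    qed (use prob_\<eta> in \<open>auto simp: indicator_particles alive_upd position_upd measurable_offspring_term measurable_cong_sets[OF sets_\<eta> refl]\<close>)
    finally show ?thesis unfolding w_def True .
  qed (simp add: a_def indicator_particles del: particles.simps)
  \<comment> \<open>The empty word is never of generation n + 1, so the sum may be reindexed by
    pairs of a parent and a child number.\<close>
  have "exp_moment (intensity \<eta> e (Suc n)) t = (\<integral>\<^sup>+u. a (Suc n) u \<partial>count_space (range (\<lambda>(v, i). i # v)))"
    unfolding moment
  proof (rule nn_integral_count_space_eq)
    fix u :: "nat list" assume "u \<in> UNIV - range (\<lambda>(v, i). i # v)"
    then have "u = []" by (cases u) auto
    then show "a (Suc n) u = 0" by (simp add: a_def indicator_particles del: particles.simps)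
  qed simp
  also have "\<dots> = (\<integral>\<^sup>+p. a (Suc n) (case p of (v, i) \<Rightarrow> i # v) \<partial>count_space UNIV)"
    by (intro nn_integral_bij_count_space[symmetric]) (auto simp: bij_betw_def inj_on_def)
  also have "\<dots> = (\<integral>\<^sup>+v. (\<integral>\<^sup>+i. a (Suc n) (i # v) \<partial>count_space UNIV) \<partial>count_space UNIV)"
    by (subst nn_integral_fst_count_space[symmetric]) simp
  also have "\<dots> = (\<integral>\<^sup>+v. a n v \<partial>count_space UNIV) * (\<integral>\<^sup>+i. w i \<partial>count_space UNIV)"
    unfolding step by (simp add: nn_integral_cmult nn_integral_multc)
  finally show ?thesis unfolding moment offspring_moment_eq w_def .
qed

lemma exp_moment_intensity: "exp_moment (intensity \<eta> e n) t = (\<Prod>k<n. offspring_moment (\<eta> (e k)) t)"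
proof (induction n)
  case 0
  interpret Q: prob_space Q by (rule prob_space_Q)
  have "exp_moment (intensity \<eta> e 0) t =
      (\<integral>\<^sup>+u. (\<integral>\<^sup>+x. indicator (particles x 0) u * ennreal (exp (t * position x u)) \<partial>Q) \<partial>count_space UNIV)"
    unfolding exp_moment_def by (rule nn_integral_intensity) simp
  also have "\<dots> = (\<integral>\<^sup>+u. indicator {[] :: nat list} u \<partial>count_space UNIV)"
    by (intro nn_integral_cong) (auto simp: indicator_def Q.emeasure_space_1)
  finally show ?case by simp
qed (simp add: exp_moment_intensity_Suc)

lemma laplace_eq: "laplace \<eta> e t = offspring_moment (\<eta> (e 0)) t"
proof -
  let ?g = "\<lambda>z. \<Sum>i<fst z. ennreal (exp (t * snd z i))"
  have distr: "distr Q (\<eta> (e 0)) (\<lambda>x. x []) = \<eta> (e 0)"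
    unfolding quenched_law_def
    using distr_PiM_component[of UNIV "\<lambda>u. \<eta> (e (length u))" "[]", OF prob_\<eta> UNIV_I] by (simp only: list.size)
  have "(\<lambda>x. x []) \<in> Q \<rightarrow>\<^sub>M \<eta> (e 0)"
    unfolding measurable_cong_sets[OF refl sets_\<eta>] by (rule measurable_component_Q)
  moreover have "?g \<in> borel_measurable (\<eta> (e 0))"
    unfolding measurable_cong_sets[OF sets_\<eta> refl] by (rule measurable_offspring_sum) simp
  ultimately have "(\<integral>\<^sup>+z. ?g z \<partial>distr Q (\<eta> (e 0)) (\<lambda>x. x [])) = (\<integral>\<^sup>+x. ?g (x []) \<partial>Q)"
    by (subst nn_integral_distr) simp_all
  then show ?thesis by (simp only: distr laplace_def offspring_moment_def)
qed

lemma shifted_environment: "quenched_environment \<eta> (\<lambda>n. e (n + k))"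
proof (rule quenched_environment.intro)
  show "prob_space (\<eta> (e (n + k)))" for n by (rule prob_\<eta>)
  show "sets (\<eta> (e (n + k))) = sets offspring_space" for n by (rule sets_\<eta>)
qed

lemma laplace_shift: "laplace \<eta> (\<lambda>n. e (n + k)) t = offspring_moment (\<eta> (e k)) t"
proof -
  from quenched_environment.laplace_eq[OF shifted_environment[of k], where t = t] show ?thesis by (simp only: add_0)
qed

text \<open>Rescaled so that a set \<open>A\<close> is charged directly instead of
  \<open>nA\<close>; the moment at \<open>n t\<close> then cancels the scaling, as the Gartner-Ellis
  lemmas expect.\<close>

definition scaled_intensity :: "nat \<Rightarrow> real measure" where
  "scaled_intensity n = distr (intensity \<eta> e n) borel (\<lambda>y. y / real n)"

lemma emeasure_scaled_intensity:
  assumes n: "n \<ge> 1" and A: "A \<in> sets borel"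
  shows "emeasure (scaled_intensity n) A = scaled_mean \<eta> e n A"
proof -
  have pre: "(\<lambda>y. y / real n) -` A = (\<lambda>y. real n * y) ` A"
  proof safe
    fix y assume "y / real n \<in> A"
    then show "y \<in> (\<lambda>y. real n * y) ` A" using n by (intro image_eqI[of _ _ "y / real n"]) auto
  qed (use n in auto)
  have "(\<lambda>y. y / real n) -` A \<inter> space borel \<in> sets borel"
    by (rule measurable_sets[OF _ A]) simp
  then have meas: "(\<lambda>y. real n * y) ` A \<in> sets borel" by (simp add: pre)
  have "emeasure (scaled_intensity n) A = emeasure (intensity \<eta> e n) ((\<lambda>y. y / real n) -` A \<inter> space (intensity \<eta> e n))"
    unfolding scaled_intensity_def
    by (rule emeasure_distr) (use A in \<open>auto simp: measurable_cong_sets[OF sets_intensity refl]\<close>)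
  also have "\<dots> = emeasure (intensity \<eta> e n) ((\<lambda>y. real n * y) ` A)"
    using sets_eq_imp_space_eq[OF sets_intensity] by (simp add: pre)
  finally show ?thesis unfolding scaled_mean_def emeasure_intensity[OF meas] .
qed

lemma exp_moment_scaled_intensity:
  assumes n: "n \<ge> 1"
  shows "exp_moment (scaled_intensity n) (real n * t) = (\<Prod>k<n. offspring_moment (\<eta> (e k)) t)"
proof -
  have "exp_moment (scaled_intensity n) (real n * t) = exp_moment (intensity \<eta> e n) t"
    unfolding exp_moment_def scaled_intensity_def
    by (subst nn_integral_distr) (use n in \<open>auto simp: measurable_cong_sets[OF sets_intensity refl] intro!: nn_integral_cong\<close>)
  then show ?thesis by (simp add: exp_moment_intensity)
qed

lemma measure_space_scaled_mean:
  assumes n: "n \<ge> 1"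
  shows "measure_space UNIV (sets borel) (scaled_mean \<eta> e n)"
proof -
  have "measure_space (space (scaled_intensity n)) (sets (scaled_intensity n)) (emeasure (scaled_intensity n))"
    by (rule measure_space)
  moreover have "sets (scaled_intensity n) = sets borel" "space (scaled_intensity n) = UNIV"
    by (simp_all add: scaled_intensity_def)
  ultimately have "measure_space UNIV (sets borel) (emeasure (scaled_intensity n))" by simp
  moreover have "sigma_sets UNIV (sets (borel :: real measure)) = sets borel"
    using sets.sigma_sets_eq[of "borel :: real measure"] by simp
  ultimately show ?thesis
    using measure_space_eq[of "sets borel" UNIV "emeasure (scaled_intensity n)" "scaled_mean \<eta> e n"] emeasure_scaled_intensity[OF n]
    by auto
qed

end

section \<open>Large deviations in a random environment\<close>

text \<open>Midpoint convexity gives the sign; writing t + h and t - h as convex combinations of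
  \<open>t\<close> with t + 1 and t - 1 gives the upper bound. Divided by \<open>h\<close>, the
  latter is free of \<open>h\<close> and serves as a dominating function.\<close>

lemma convex_second_difference:
  fixes g :: "real \<Rightarrow> real"
  assumes g: "convex_on UNIV g" and h: "0 \<le> h" "h \<le> 1"
  shows "0 \<le> g (t + h) + g (t - h) - 2 * g t"
    and "g (t + h) + g (t - h) - 2 * g t \<le> h * (g (t + 1) + g (t - 1) - 2 * g t)"
proof -
  have "g t \<le> (1 - 1 / 2) * g (t + h) + 1 / 2 * g (t - h)"
    using convex_onD[OF g, of "1 / 2" "t + h" "t - h"] by (simp add: field_simps)
  then show "0 \<le> g (t + h) + g (t - h) - 2 * g t" by simp
  have "g (t + h) \<le> (1 - h) * g t + h * g (t + 1)"
    using convex_onD[OF g, of h t "t + 1"] h by (simp add: algebra_simps)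
  moreover have "g (t - h) \<le> (1 - h) * g t + h * g (t - 1)"
    using convex_onD[OF g, of h t "t - 1"] h by (simp add: algebra_simps)
  ultimately show "g (t + h) + g (t - h) - 2 * g t \<le> h * (g (t + 1) + g (t - 1) - 2 * g t)"
    by (simp add: algebra_simps)
qed

lemma ereal_integrableD:
  assumes "ereal_integrable \<tau> f"
  shows "integrable \<tau> (\<lambda>e. real_of_ereal (f e))" and "AE e in \<tau>. \<bar>f e\<bar> \<noteq> \<infinity>"
proof -
  have f [measurable]: "f \<in> borel_measurable \<tau>" and fin: "(\<integral>\<^sup>+e. e2ennreal \<bar>f e\<bar> \<partial>\<tau>) < \<infinity>"
    using assms by (auto simp: ereal_integrable_def)
  have "ennreal (norm (real_of_ereal z)) \<le> e2ennreal \<bar>z\<bar>" for z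
    by (cases z) (auto simp: e2ennreal_ereal)
  then have "(\<integral>\<^sup>+e. ennreal (norm (real_of_ereal (f e))) \<partial>\<tau>) \<le> (\<integral>\<^sup>+e. e2ennreal \<bar>f e\<bar> \<partial>\<tau>)"
    by (intro nn_integral_mono)
  then show "integrable \<tau> (\<lambda>e. real_of_ereal (f e))"
    using fin by (intro integrableI_bounded) (auto intro: le_less_trans)
  have "AE e in \<tau>. e2ennreal \<bar>f e\<bar> \<noteq> \<infinity>"
    using fin by (intro nn_integral_PInf_AE) auto
  then show "AE e in \<tau>. \<bar>f e\<bar> \<noteq> \<infinity>" by eventually_elim auto
qed

lemma elog_finiteD: "\<bar>elog x\<bar> \<noteq> \<infinity> \<Longrightarrow> 0 < x \<and> x < \<infinity>"
  by (cases "x = 0"; cases "x = \<top>") (auto simp: elog_def zero_less_iff_neq_zero less_top)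

lemma AE_comp_power:
  assumes T: "T \<in> \<tau> \<rightarrow>\<^sub>M \<tau>" and inv: "distr \<tau> \<tau> T = \<tau>" and P: "AE x in \<tau>. P x"
  shows "AE x in \<tau>. P ((T ^^ k) x)"
proof (induction k)
  case (Suc k)
  have "AE x in distr \<tau> \<tau> T. P ((T ^^ k) x)" unfolding inv by (rule Suc)
  then have "AE x in \<tau>. P ((T ^^ k) (T x))" by (rule AE_distrD[OF T])
  then show ?case by (simp add: funpow_Suc_right del: funpow.simps)
qed (use P in simp)

lemma shift_power: "((\<lambda>e n. e (Suc n)) ^^ k) e = (\<lambda>n. e (n + k))"
  by (induction k arbitrary: e) (simp_all add: funpow_Suc_right del: funpow.simps)

text \<open>Realises the offspring moments of generation \<open>k\<close> as exponential moments of
  a measure on the line, so that the results on \<open>log_moment\<close> apply to them.\<close>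

definition one_step :: "('th \<Rightarrow> offspring measure) \<Rightarrow> (nat \<Rightarrow> 'th) \<Rightarrow> nat \<Rightarrow> real measure" where
  "one_step \<eta> e k = intensity \<eta> (\<lambda>n. e (n + k)) 1"

context quenched_environment
begin

lemma exp_moment_one_step: "exp_moment (one_step \<eta> e k) t = offspring_moment (\<eta> (e k)) t"
proof -
  from quenched_environment.exp_moment_intensity[OF shifted_environment[of k], where n = 1 and t = t] show ?thesis
    by (simp add: one_step_def)
qed

lemma exp_moments_finite_one_step:
  assumes "\<And>q. q \<in> \<rat> \<Longrightarrow> 0 < laplace \<eta> (\<lambda>n. e (n + k)) q \<and> laplace \<eta> (\<lambda>n. e (n + k)) q < \<infinity>"
  shows "exp_moments_finite (one_step \<eta> e k)"
proof (rule exp_moments_finiteI)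
  show "sets (one_step \<eta> e k) = sets borel" by (simp add: one_step_def intensity_def)
qed (use assms in \<open>simp add: exp_moment_one_step laplace_shift\<close>)

lemma elog_laplace_shift:
  assumes "exp_moments_finite (one_step \<eta> e k)"
  shows "elog (laplace \<eta> (\<lambda>n. e (n + k)) t) = ereal (log_moment (one_step \<eta> e k) t)"
  using elog_exp_moment[OF assms] by (simp add: exp_moment_one_step laplace_shift)

lemma exp_moment_scaled_intensity_log:
  assumes n: "n \<ge> 1" and fin: "\<And>k. exp_moments_finite (one_step \<eta> e k)"
  shows "exp_moment (scaled_intensity n) (real n * t) =
    ennreal (exp (real n * ((\<Sum>k<n. log_moment (one_step \<eta> e k) t) / real n)))"
proof -
  have "offspring_moment (\<eta> (e k)) t = ennreal (exp (log_moment (one_step \<eta> e k) t))" for k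
    using exp_moment_eq[OF fin] by (simp flip: exp_moment_one_step)
  then have "exp_moment (scaled_intensity n) (real n * t) = (\<Prod>k<n. ennreal (exp (log_moment (one_step \<eta> e k) t)))"
    by (simp add: exp_moment_scaled_intensity[OF n])
  also have "\<dots> = ennreal (exp (\<Sum>k<n. log_moment (one_step \<eta> e k) t))"
    by (simp add: prod_ennreal exp_sum)
  finally show ?thesis using n by simp
qed

text \<open>The environment is fixed here, and what is known about it almost surely appears as
  hypotheses that mention no set \<open>A\<close>. The exceptional null set therefore serves all
  Borel sets at once.\<close>

lemma quenched_large_deviations:
  fixes \<Lambda> :: "real \<Rightarrow> real"
  assumes fin: "\<And>k. exp_moments_finite (one_step \<eta> e k)"
    and lim: "\<And>q. q \<in> \<rat> \<Longrightarrow> (\<lambda>n. (\<Sum>k<n. log_moment (one_step \<eta> e k) q) / real n) \<longlonglongrightarrow> \<Lambda> q"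
    and convex: "convex_on UNIV \<Lambda>"
    and smooth: "\<And>t. (\<lambda>k. real (Suc k) * (\<Lambda> (t + 1 / Suc k) + \<Lambda> (t - 1 / Suc k) - 2 * \<Lambda> t)) \<longlonglongrightarrow> 0"
    and A: "A \<in> sets borel"
  shows "- (INF x\<in>interior A. SUP t. ereal (x * t - \<Lambda> t)) \<le> liminf (\<lambda>n. ereal (1 / real n) * elog (scaled_mean \<eta> e n A))"
    and "limsup (\<lambda>n. ereal (1 / real n) * elog (scaled_mean \<eta> e n A)) \<le> - (INF x\<in>closure A. SUP t. ereal (x * t - \<Lambda> t))"
proof -
  let ?L = "\<lambda>n t. (\<Sum>k<n. log_moment (one_step \<eta> e k) t) / real n"
  let ?a = "\<lambda>n. ereal (1 / real n) * elog (emeasure (scaled_intensity n) A)"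
  let ?b = "\<lambda>n. ereal (1 / real n) * elog (scaled_mean \<eta> e n A)"
  have convL: "convex_on UNIV (\<lambda>t. ?L n t)" for n
  proof -
    have "convex_on UNIV (\<lambda>t. \<Sum>k<n. log_moment (one_step \<eta> e k) t)"
      by (induction n) (auto intro!: convex_on_add convex_log_moment fin simp: convex_on_def[of _ "\<lambda>_. 0"])
    from convex_on_cmul[OF _ this, of "1 / real n"] show ?thesis by simp
  qed
  have limL: "(\<lambda>n. ?L n t) \<longlonglongrightarrow> \<Lambda> t" for t
    by (rule convex_pointwise_limit[OF convL convex lim])
  have sets: "sets (scaled_intensity n) = sets borel" for n by (simp add: scaled_intensity_def)
  have cont: "continuous_on UNIV \<Lambda>" by (rule convex_on_continuous) (use convex in auto)
  \<comment> \<open>Agreement is guaranteed only from n = 1 on, since rescaling divides by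
    \<open>n\<close>; the limits do not see n = 0.\<close>
  have ev: "\<forall>\<^sub>F n in sequentially. ?a n = ?b n"
    using eventually_ge_at_top[of 1] by eventually_elim (simp add: emeasure_scaled_intensity A)
  show "- (INF x\<in>interior A. SUP t. ereal (x * t - \<Lambda> t)) \<le> liminf ?b"
    unfolding Liminf_eq[OF ev, symmetric]
    by (rule gartner_ellis_lower[where L = ?L]) (use sets exp_moment_scaled_intensity_log fin limL cont smooth A in auto)
  show "limsup ?b \<le> - (INF x\<in>closure A. SUP t. ereal (x * t - \<Lambda> t))"
    unfolding Limsup_eq[OF ev, symmetric]
    by (rule gartner_ellis_upper[where L = ?L]) (use sets exp_moment_scaled_intensity_log fin limL in auto)
qed

end

locale ergodic_environment =
  fixes \<Theta> :: "'th measure" and \<eta> :: "'th \<Rightarrow> offspring measure" and \<tau> :: "(nat \<Rightarrow> 'th) measure"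
  assumes prob_\<tau>: "prob_space \<tau>"
    and sets_\<tau>: "sets \<tau> = sets (\<Pi>\<^sub>M n\<in>(UNIV :: nat set). \<Theta>)"
    and shift_invariant: "distr \<tau> \<tau> (\<lambda>e n. e (Suc n)) = \<tau>"
    and shift_ergodic: "\<And>A. A \<in> sets \<tau> \<Longrightarrow> (\<lambda>e n. e (Suc n)) -` A \<inter> space \<tau> = A \<Longrightarrow>
      measure \<tau> A = 0 \<or> measure \<tau> A = 1"
    and \<eta>: "\<eta> \<in> \<Theta> \<rightarrow>\<^sub>M prob_algebra offspring_space"
    and integrable_laplace: "\<And>t. ereal_integrable \<tau> (\<lambda>e. elog (laplace \<eta> e t))"
begin

definition log_laplace :: "real \<Rightarrow> (nat \<Rightarrow> 'th) \<Rightarrow> real" where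
  "log_laplace t e = real_of_ereal (elog (laplace \<eta> e t))"

lemma measurable_shift: "(\<lambda>e n. e (Suc n)) \<in> \<tau> \<rightarrow>\<^sub>M \<tau>"
  unfolding measurable_cong_sets[OF sets_\<tau> sets_\<tau>]
  by (rule measurable_PiM_single') (auto simp: space_PiM)

lemma quenched_environment:
  assumes "e \<in> space \<tau>"
  shows "quenched_environment \<eta> e"
proof (rule quenched_environment.intro)
  fix k
  have "e k \<in> space \<Theta>" using assms sets_eq_imp_space_eq[OF sets_\<tau>] by (auto simp: space_PiM)
  then have "\<eta> (e k) \<in> space (prob_algebra offspring_space)" by (rule measurable_space[OF \<eta>])
  then show "prob_space (\<eta> (e k))" "sets (\<eta> (e k)) = sets offspring_space"
    by (auto simp: space_prob_algebra)
qed

lemma integrable_log_laplace: "integrable \<tau> (log_laplace t)"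
  using ereal_integrableD(1)[OF integrable_laplace] by (simp add: log_laplace_def[abs_def])

lemma \<Lambda>_eq: "\<Lambda> \<eta> \<tau> t = (\<integral>e. log_laplace t e \<partial>\<tau>)"
  by (simp add: \<Lambda>_def ereal_expectation_def log_laplace_def)

text \<open>An integrable logarithm excludes the values 0 and \<infinity> almost surely at each
  rational, and invariance under the shift carries this to every generation.\<close>

lemma AE_exp_moments_finite: "AE e in \<tau>. \<forall>k. exp_moments_finite (one_step \<eta> e k)"
proof -
  have "AE e in \<tau>. \<forall>q\<in>\<rat>. 0 < laplace \<eta> e q \<and> laplace \<eta> e q < \<infinity>"
  proof (rule AE_ball_countable')
    fix q :: real
    show "AE e in \<tau>. 0 < laplace \<eta> e q \<and> laplace \<eta> e q < \<infinity>"
      using ereal_integrableD(2)[OF integrable_laplace[of q]] by eventually_elim (rule elog_finiteD)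
  qed (rule countable_rat)
  then have "AE e in \<tau>. \<forall>k. \<forall>q\<in>\<rat>. 0 < laplace \<eta> (((\<lambda>e n. e (Suc n)) ^^ k) e) q \<and> laplace \<eta> (((\<lambda>e n. e (Suc n)) ^^ k) e) q < \<infinity>"
    unfolding AE_all_countable by (intro allI AE_comp_power[OF measurable_shift shift_invariant])
  with AE_space show ?thesis
  proof eventually_elim
    case (elim e)
    then show ?case unfolding shift_power
      by (auto intro!: quenched_environment.exp_moments_finite_one_step quenched_environment)
  qed
qed

lemma log_laplace_shift_power:
  assumes "e \<in> space \<tau>" "\<forall>k. exp_moments_finite (one_step \<eta> e k)"
  shows "log_laplace t (((\<lambda>e n. e (Suc n)) ^^ k) e) = log_moment (one_step \<eta> e k) t"
  using quenched_environment.elog_laplace_shift[OF quenched_environment[OF assms(1)], of k t] assms(2)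
  by (simp add: log_laplace_def shift_power)

lemma AE_log_laplace_regular:
  "AE e in \<tau>. convex_on UNIV (\<lambda>t. log_laplace t e) \<and>
     (\<forall>t. \<exists>C. \<forall>h. 0 \<le> h \<longrightarrow> h \<le> 1 \<longrightarrow> log_laplace (t + h) e + log_laplace (t - h) e - 2 * log_laplace t e \<le> C * h\<^sup>2)"
  using AE_space AE_exp_moments_finite
proof eventually_elim
  case (elim e)
  then have eq: "log_laplace t e = log_moment (one_step \<eta> e 0) t" for t using log_laplace_shift_power[of e t 0] by simp
  have fin: "exp_moments_finite (one_step \<eta> e 0)" using elim by blast
  have "(\<lambda>t. log_laplace t e) = log_moment (one_step \<eta> e 0)" by (rule ext) (rule eq)
  then have "convex_on UNIV (\<lambda>t. log_laplace t e)" using convex_log_moment[OF fin] by simp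
  moreover have "\<exists>C. \<forall>h. 0 \<le> h \<longrightarrow> h \<le> 1 \<longrightarrow> log_laplace (t + h) e + log_laplace (t - h) e - 2 * log_laplace t e \<le> C * h\<^sup>2" for t
    unfolding eq using log_moment_second_difference[OF fin, of t] by metis
  ultimately show ?case by blast
qed

lemma convex_\<Lambda>: "convex_on UNIV (\<Lambda> \<eta> \<tau>)"
proof (rule convex_onI)
  fix u a b :: real assume u: "0 < u" "u < 1"
  have "\<Lambda> \<eta> \<tau> ((1 - u) *\<^sub>R a + u *\<^sub>R b) \<le> (\<integral>e. (1 - u) * log_laplace a e + u * log_laplace b e \<partial>\<tau>)"
    unfolding \<Lambda>_eq
  proof (rule integral_mono_AE)
    show "AE e in \<tau>. log_laplace ((1 - u) *\<^sub>R a + u *\<^sub>R b) e \<le> (1 - u) * log_laplace a e + u * log_laplace b e"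
      using AE_log_laplace_regular by eventually_elim (use u in \<open>auto dest!: convex_onD[where t = u and x = a and y = b]\<close>)
  qed (use integrable_log_laplace in auto)
  also have "\<dots> = (1 - u) * \<Lambda> \<eta> \<tau> a + u * \<Lambda> \<eta> \<tau> b"
    using integrable_log_laplace by (simp add: \<Lambda>_eq)
  finally show "\<Lambda> \<eta> \<tau> ((1 - u) *\<^sub>R a + u *\<^sub>R b) \<le> (1 - u) * \<Lambda> \<eta> \<tau> a + u * \<Lambda> \<eta> \<tau> b" .
qed simp

text \<open>Almost surely the quotient is at most C/(k+1), with C depending on the environment, and
  so tends to zero; convexity bounds it by the second difference at step 1, which is
  integrable.\<close>

lemma \<Lambda>_second_difference:
  "(\<lambda>k. real (Suc k) * (\<Lambda> \<eta> \<tau> (t + 1 / Suc k) + \<Lambda> \<eta> \<tau> (t - 1 / Suc k) - 2 * \<Lambda> \<eta> \<tau> t)) \<longlonglongrightarrow> 0"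
proof -
  define D where "D k e = real (Suc k) * (log_laplace (t + 1 / Suc k) e + log_laplace (t - 1 / Suc k) e - 2 * log_laplace t e)" for k e
  have int_D: "integrable \<tau> (D k)" for k
    unfolding D_def by (intro integrable_mult_right Bochner_Integration.integrable_add Bochner_Integration.integrable_diff integrable_log_laplace)
  have D_eq: "(\<integral>e. D k e \<partial>\<tau>) = real (Suc k) * (\<Lambda> \<eta> \<tau> (t + 1 / Suc k) + \<Lambda> \<eta> \<tau> (t - 1 / Suc k) - 2 * \<Lambda> \<eta> \<tau> t)" for k
    unfolding D_def \<Lambda>_eq using integrable_log_laplace by simp
  have "(\<lambda>k. \<integral>e. D k e \<partial>\<tau>) \<longlonglongrightarrow> (\<integral>e. 0 \<partial>\<tau>)"
  proof (rule integral_dominated_convergence)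
    show "integrable \<tau> (\<lambda>e. log_laplace (t + 1) e + log_laplace (t - 1) e - 2 * log_laplace t e)" using integrable_log_laplace by auto
    have h: "0 \<le> 1 / real (Suc k)" "1 / real (Suc k) \<le> 1" for k by auto
    show "AE e in \<tau>. norm (D k e) \<le> log_laplace (t + 1) e + log_laplace (t - 1) e - 2 * log_laplace t e" for k
      using AE_log_laplace_regular
    proof eventually_elim
      case (elim e)
      let ?d = "log_laplace (t + 1 / Suc k) e + log_laplace (t - 1 / Suc k) e - 2 * log_laplace t e"
      have 1: "0 \<le> ?d" "?d \<le> 1 / Suc k * (log_laplace (t + 1) e + log_laplace (t - 1) e - 2 * log_laplace t e)"
        using convex_second_difference[OF _ h[of k], of "\<lambda>t. log_laplace t e" t] elim by auto
      then have "real (Suc k) * ?d \<le> real (Suc k) * (1 / Suc k * (log_laplace (t + 1) e + log_laplace (t - 1) e - 2 * log_laplace t e))"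
        by (intro mult_left_mono) auto
      then show ?case using 1(1) unfolding D_def by (simp add: abs_mult del: of_nat_Suc)
    qed
    show "AE e in \<tau>. (\<lambda>k. D k e) \<longlonglongrightarrow> 0"
      using AE_log_laplace_regular
    proof eventually_elim
      case (elim e)
      obtain C where C: "\<And>h. 0 \<le> h \<Longrightarrow> h \<le> 1 \<Longrightarrow> log_laplace (t + h) e + log_laplace (t - h) e - 2 * log_laplace t e \<le> C * h\<^sup>2"
        using elim by blast
      show ?case
      proof (rule tendsto_sandwich)
        show "\<forall>\<^sub>F k in sequentially. 0 \<le> D k e"
          using convex_second_difference(1)[OF _ h, of "\<lambda>t. log_laplace t e" t] elim
          by (intro always_eventually allI) (auto simp: D_def)
        show "\<forall>\<^sub>F k in sequentially. D k e \<le> C * inverse (real (Suc k))"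
        proof (intro always_eventually allI)
          fix k
          have "D k e \<le> real (Suc k) * (C * (1 / real (Suc k))\<^sup>2)"
            unfolding D_def by (intro mult_left_mono C h) auto
          also have "\<dots> = C * inverse (real (Suc k))"
            by (simp add: power2_eq_square divide_inverse del: of_nat_Suc)
          finally show "D k e \<le> C * inverse (real (Suc k))" .
        qed
        show "(\<lambda>k. C * inverse (real (Suc k))) \<longlonglongrightarrow> 0"
          by (rule tendsto_mult_right_zero[OF LIMSEQ_inverse_real_of_nat])
      qed simp
    qed
  qed (use int_D in auto)
  then show ?thesis by (simp only: D_eq) simp
qed

lemma AE_log_moment_averages:
  "AE e in \<tau>. \<forall>q\<in>\<rat>. (\<lambda>n. (\<Sum>k<n. log_moment (one_step \<eta> e k) q) / real n) \<longlonglongrightarrow> \<Lambda> \<eta> \<tau> q"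
proof (rule AE_ball_countable')
  fix q :: real
  have "AE e in \<tau>. (\<lambda>n. (\<Sum>k<n. log_laplace q (((\<lambda>e n. e (Suc n)) ^^ k) e)) / real n) \<longlonglongrightarrow> (\<integral>e. log_laplace q e \<partial>\<tau>)"
    by (rule birkhoff_ergodic[OF prob_\<tau> measurable_shift shift_invariant shift_ergodic integrable_log_laplace])
  with AE_space AE_exp_moments_finite
  show "AE e in \<tau>. (\<lambda>n. (\<Sum>k<n. log_moment (one_step \<eta> e k) q) / real n) \<longlonglongrightarrow> \<Lambda> \<eta> \<tau> q"
    by eventually_elim (simp add: log_laplace_shift_power \<Lambda>_eq)
qed (rule countable_rat)

theorem large_deviations:
  "AE e in \<tau>.
    (\<forall>n\<ge>1. measure_space UNIV (sets borel) (scaled_mean \<eta> e n) \<and> scaled_mean \<eta> e n UNIV < \<infinity>) \<and>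
    (\<forall>A\<in>sets (borel :: real measure).
      - (INF x\<in>interior A. \<Lambda>_star \<eta> \<tau> x)
          \<le> liminf (\<lambda>n. ereal (1 / real n) * elog (scaled_mean \<eta> e n A)) \<and>
      liminf (\<lambda>n. ereal (1 / real n) * elog (scaled_mean \<eta> e n A))
          \<le> limsup (\<lambda>n. ereal (1 / real n) * elog (scaled_mean \<eta> e n A)) \<and>
      limsup (\<lambda>n. ereal (1 / real n) * elog (scaled_mean \<eta> e n A))
          \<le> - (INF x\<in>closure A. \<Lambda>_star \<eta> \<tau> x))"
  using AE_space AE_exp_moments_finite AE_log_moment_averages
proof eventually_elim
  case (elim e)
  interpret E: quenched_environment \<eta> e by (rule quenched_environment) (rule elim)
  have fin: "\<And>k. exp_moments_finite (one_step \<eta> e k)" using elim by blast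
  have "scaled_mean \<eta> e n UNIV < \<infinity>" if n: "n \<ge> 1" for n
  proof -
    \<comment> \<open>The total mass is the exponential moment at 0, hence finite by the product
      formula.\<close>
    have "scaled_mean \<eta> e n UNIV = exp_moment (E.scaled_intensity n) (real n * 0)"
      using E.emeasure_scaled_intensity[OF n, of UNIV] by (simp add: exp_moment_def E.scaled_intensity_def)
    then show ?thesis by (simp only: E.exp_moment_scaled_intensity_log[OF n fin]) simp
  qed
  moreover have "liminf (\<lambda>n. ereal (1 / real n) * elog (scaled_mean \<eta> e n A))
      \<le> limsup (\<lambda>n. ereal (1 / real n) * elog (scaled_mean \<eta> e n A))" for A
    by (rule Liminf_le_Limsup) simp
  ultimately show ?case
    using E.measure_space_scaled_mean E.quenched_large_deviations[OF fin _ convex_\<Lambda> \<Lambda>_second_difference] elim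
    unfolding \<Lambda>_star_def by blast
qed

end

theorem theorem2p1:
  fixes M :: "'a measure" and \<Theta> :: "'th measure" and \<xi> :: "nat \<Rightarrow> 'a \<Rightarrow> 'th"
    and \<eta> :: "'th \<Rightarrow> offspring measure" and \<tau> :: "(nat \<Rightarrow> 'th) measure"
  assumes "prob_space M"
    and "\<And>n. \<xi> n \<in> M \<rightarrow>\<^sub>M \<Theta>"
    and "stationary M \<Theta> \<xi>"
    and "ergodic M \<Theta> \<xi>"
    and "\<eta> \<in> \<Theta> \<rightarrow>\<^sub>M prob_algebra offspring_space"
    and "\<tau> = process_law M \<Theta> \<xi>"
    and "ereal_integrable \<tau> (\<lambda>e. elog (mean_offspring \<eta> e))"
    and "ereal_expectation \<tau> (\<lambda>e. elog (mean_offspring \<eta> e)) > 0"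
    and "annealed_nn_expectation \<eta> \<tau>
           (\<lambda>e x. of_nat (fst (x [])) / mean_offspring \<eta> e * ennreal (max 0 (ln (real (fst (x [])))))) < \<infinity>"
    and "annealed_nn_expectation \<eta> \<tau> (\<lambda>e x. ennreal \<bar>snd (x []) 0\<bar>) < \<infinity>"
    and "\<And>t. ereal_integrable \<tau> (\<lambda>e. elog (laplace \<eta> e t))"
    and "\<And>t. (\<integral>\<^sup>+e. ennreal \<bar>deriv (\<lambda>s. enn2real (laplace \<eta> e s)) t / enn2real (laplace \<eta> e t)\<bar> \<partial>\<tau>) < \<infinity>"
  shows "AE e in \<tau>.
    (\<forall>n\<ge>1. measure_space UNIV (sets borel) (scaled_mean \<eta> e n) \<and> scaled_mean \<eta> e n UNIV < \<infinity>) \<and>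
    (\<forall>A\<in>sets (borel :: real measure).
      - (INF x\<in>interior A. \<Lambda>_star \<eta> \<tau> x)
          \<le> liminf (\<lambda>n. ereal (1 / real n) * elog (scaled_mean \<eta> e n A)) \<and>
      liminf (\<lambda>n. ereal (1 / real n) * elog (scaled_mean \<eta> e n A))
          \<le> limsup (\<lambda>n. ereal (1 / real n) * elog (scaled_mean \<eta> e n A)) \<and>
      limsup (\<lambda>n. ereal (1 / real n) * elog (scaled_mean \<eta> e n A))
          \<le> - (INF x\<in>closure A. \<Lambda>_star \<eta> \<tau> x))"
proof (rule ergodic_environment.large_deviations[where \<Theta> = \<Theta>], rule ergodic_environment.intro)
  note [measurable] = assms(2)
  let ?S = "\<Pi>\<^sub>M n\<in>(UNIV :: nat set). \<Theta>"
  have path: "(\<lambda>\<omega> n. \<xi> n \<omega>) \<in> M \<rightarrow>\<^sub>M ?S"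
    by (rule measurable_PiM_single') (auto simp: space_PiM intro: measurable_space[OF assms(2)])
  have shift: "(\<lambda>e n. e (Suc n)) \<in> ?S \<rightarrow>\<^sub>M ?S"
    by (rule measurable_PiM_single') (auto simp: space_PiM intro: measurable_space[OF assms(2)])
  have \<tau>: "\<tau> = distr M ?S (\<lambda>\<omega> n. \<xi> n \<omega>)" using assms(6) by (simp add: process_law_def)
  show "prob_space \<tau>" unfolding \<tau> by (rule prob_space.prob_space_distr[OF assms(1) path])
  show sets: "sets \<tau> = sets ?S" by (simp add: \<tau>)
  have space: "space \<tau> = space ?S" by (rule sets_eq_imp_space_eq[OF sets])
  \<comment> \<open>Shifting a path of the process gives a path of the shifted process, so
    stationarity of \<xi> is invariance of its law under the shift.\<close>
  have "distr \<tau> \<tau> (\<lambda>e n. e (Suc n)) = distr \<tau> ?S (\<lambda>e n. e (Suc n))"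
    by (rule distr_cong) (simp_all add: sets)
  also have "\<dots> = distr M ?S ((\<lambda>e n. e (Suc n)) \<circ> (\<lambda>\<omega> n. \<xi> n \<omega>))"
    unfolding \<tau> by (rule distr_distr[OF shift path])
  also have "\<dots> = process_law M \<Theta> (\<lambda>n. \<xi> (Suc n))" by (simp add: process_law_def comp_def)
  also have "\<dots> = \<tau>" using assms(3,6) by (simp add: stationary_def)
  finally show "distr \<tau> \<tau> (\<lambda>e n. e (Suc n)) = \<tau>" .
  show "measure \<tau> A = 0 \<or> measure \<tau> A = 1"
    if "A \<in> sets \<tau>" "(\<lambda>e n. e (Suc n)) -` A \<inter> space \<tau> = A" for A
    using assms(4) that unfolding ergodic_def sets space assms(6)[symmetric] by blast
qed (fact assms)+

end
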